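(* Let $p,q_1,\dots,q_{s+t}$ be distinct odd primes, where $s,t\ge 0$ are integers, and let $e$ be a positive integer. If $$N=p^{e}\,q_1^{2}\cdots q_s^{2}\,q_{s+1}^{4}\cdots q_{s+t}^{4}$$ is an odd perfect number, then $N$ has a prime factor less than $\exp(4.97401\times 10^{10})$.
   Context: A positive integer $N$ is perfect if $\sigma(N)=2N$, where $\sigma(N)$ is the sum of the positive divisors of $N$. *)

theory Defs
  imports Complex_Main "HOL-Computational_Algebra.Primes"
begin

definition divisor_sigma :: "nat \<Rightarrow> nat" where
  "divisor_sigma N = \<Sum>{d. d dvd N}"

(* Positivity is needed explicitly: the set of divisors of 0 is infinite, so
   divisor_sigma 0 = 0 and 0 would otherwise count as perfect. *)
definition perfect_number :: "nat \<Rightarrow> bool" where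
  "perfect_number N \<longleftrightarrow> N > 0 \<and> divisor_sigma N = 2 * N"

end

theory Submission
  imports Defs "HOL-Analysis.Harmonic_Numbers" "HOL-Number_Theory.Number_Theory"
begin

text \<open>Let \<open>l\<close> be 3 or 5 and let \<open>q\<close> be a prime occurring in \<open>N\<close> with exponent \<open>l - 1\<close>. Then
  \<open>1 + q + \<dots> + q ^ (l - 1)\<close> divides \<open>2 * N\<close>, so modulo every odd prime \<open>r\<close> not dividing \<open>N\<close> the prime
  \<open>q\<close> avoids 0 and, if \<open>r\<close> is 1 modulo \<open>l\<close>, the \<open>l - 1\<close> roots of this polynomial. On average these
  are two residue classes for each prime. Since the sum of \<open>1 / r\<close> over the primes dividing \<open>N\<close> is at
  most 0.7, hardly any primes are lost by leaving out the divisors of \<open>N\<close>, and a sieve of dimension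
  two shows that there are, up to powers of \<open>ln (ln x)\<close>, at most \<open>O(x / (ln x)\<^sup>2)\<close> such \<open>q\<close> below \<open>x\<close>.
  Hence if all prime factors of \<open>N\<close> are huge, the sum of their reciprocals is too small for the
  product of \<open>r / (r - 1)\<close> to exceed \<open>2\<close>. As the bound \<open>exp (4.97401 * 10 ^ 10)\<close> exceeds \<open>2 ^ 2 ^ 36\<close>,
  Brun's pure sieve is sufficient, together with Mertens' elementary treatment of primes congruent
  to 1 modulo 3 and 5.\<close>

section \<open>Numerical bounds for logarithms\<close>

lemma ln2_le_seven_tenths: "ln (2::real) \<le> 7/10"
  using ln2_le_25_over_36 by simp

lemma ln3_le: "ln (3::real) \<le> 11/10"
  using ln_approx_bounds[of 3 2] by (simp add: eval_nat_numeral)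

lemma one_le_ln3: "1 \<le> ln (3::real)"
  using ln_approx_bounds[of 3 2] by (simp add: eval_nat_numeral)

section \<open>Character sums over prime powers\<close>

text \<open>Abel summation: each drop \<open>b k - b (Suc k)\<close> is multiplied by a partial sum
  of norm at most \<open>B\<close>, so the drops telescope to \<open>B * (b m - b n)\<close>; the
  boundary term adds \<open>B * b n\<close>.\<close>

lemma norm_sum_mult_antimono_le:
  fixes a :: "nat \<Rightarrow> complex" and b :: "nat \<Rightarrow> real"
  assumes "m \<le> n"
    and A: "\<And>k. norm (\<Sum>i=m..k. a i) \<le> B"
    and b: "\<And>k. m \<le> k \<Longrightarrow> b (Suc k) \<le> b k" "\<And>k. m \<le> k \<Longrightarrow> 0 \<le> b k"
  shows "norm (\<Sum>k=m..n. a k * of_real (b k)) \<le> B * b m"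
proof -
  define S where "S = (\<lambda>k. \<Sum>i=m..k. a i)"
  have "0 \<le> B" using norm_ge_zero A[of m] by (rule order_trans)
  have "norm ((\<Sum>k=m..n. a k * of_real (b k)) - S n * of_real (b n)) \<le> B * (b m - b n)"
    using assms(1)
  proof (induction n rule: dec_induct)
    case base
    show ?case by (simp add: S_def)
  next
    case (step n)
    have "(\<Sum>k=m..Suc n. a k * of_real (b k)) - S (Suc n) * of_real (b (Suc n))
        = ((\<Sum>k=m..n. a k * of_real (b k)) - S n * of_real (b n)) + S n * of_real (b n - b (Suc n))"
      using step.hyps by (simp add: S_def algebra_simps)
    also have "norm \<dots> \<le> B * (b m - b n) + B * (b n - b (Suc n))"
    proof (rule norm_triangle_mono[OF step.IH])
      show "norm (S n * of_real (b n - b (Suc n))) \<le> B * (b n - b (Suc n))"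
        using A[of n] b(1)[of n] step.hyps \<open>0 \<le> B\<close> unfolding S_def norm_mult norm_of_real
        by (intro mult_mono) auto
    qed
    finally show ?case by (simp add: algebra_simps)
  qed
  moreover have "norm (S n * of_real (b n)) \<le> B * b n"
    using A[of n] b(2)[of n] \<open>m \<le> n\<close> \<open>0 \<le> B\<close> unfolding S_def norm_mult norm_of_real
    by (intro mult_mono) auto
  ultimately have "norm ((\<Sum>k=m..n. a k * of_real (b k)) - S n * of_real (b n) + S n * of_real (b n))
      \<le> B * (b m - b n) + B * b n"
    by (rule norm_triangle_mono)
  then show ?thesis by (simp add: algebra_simps)
qed

section \<open>Chebyshev and Mertens estimates for the von Mangoldt function\<close>

lemma sum_divisors_eq_sum_hyperbola:
  fixes F :: "nat \<Rightarrow> nat \<Rightarrow> 'a::comm_monoid_add"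
  shows "(\<Sum>k=1..n. \<Sum>d | d dvd k. F d (k div d)) = (\<Sum>d=1..n. \<Sum>j=1..n div d. F d j)"
proof -
  have "(\<Sum>k=1..n. \<Sum>d | d dvd k. F d (k div d))
      = (\<Sum>(k, d)\<in>Sigma {1..n} (\<lambda>k. {d. d dvd k}). F d (k div d))"
    by (subst sum.Sigma) auto
  also have "\<dots> = (\<Sum>(d, j)\<in>Sigma {1..n} (\<lambda>d. {1..n div d}). F d j)"
    by (rule sum.reindex_bij_witness[where i = "\<lambda>(d, j). (d * j, d)" and j = "\<lambda>(k, d). (d, k div d)"])
      (auto simp: less_eq_div_iff_mult_less_eq mult.commute div_le_mono Suc_le_eq intro: dvd_pos_nat order_trans[OF dvd_imp_le])
  also have "\<dots> = (\<Sum>d=1..n. \<Sum>j=1..n div d. F d j)"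
    by (subst sum.Sigma) auto
  finally show ?thesis .
qed

text \<open>Every \<open>ln k\<close> splits into \<open>mangoldt d\<close> over the divisors of
  \<open>k\<close>, and \<open>d\<close> divides exactly \<open>n div d\<close> of the numbers up to
  \<open>n\<close>.\<close>

lemma ln_fact_eq_sum_mangoldt:
  "ln (fact n :: real) = (\<Sum>d=1..n. mangoldt d * real (n div d))"
proof -
  have "ln (fact n :: real) = (\<Sum>k=1..n. ln (real k))"
    by (induction n) (auto simp: ln_mult)
  also have "\<dots> = (\<Sum>k=1..n. \<Sum>d | d dvd k. mangoldt d)"
    by (intro sum.cong refl) (simp add: mangoldt_sum)
  also have "\<dots> = (\<Sum>d=1..n. mangoldt d * real (n div d))"
    using sum_divisors_eq_sum_hyperbola[of "\<lambda>d _. mangoldt d :: real" n] by (simp add: mult.commute)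
  finally show ?thesis .
qed

lemma ln_fact_ge: 
  assumes "n \<ge> 1" shows "ln (fact n :: real) \<ge> real n * ln (real n) - real n"
  using assms
proof (induction n rule: dec_induct)
  case base
  show ?case by simp
next
  case (step n)
  have "real n * (ln (real (Suc n)) - ln (real n)) \<le> 1"
  proof -
    have "ln (real (Suc n)) - ln (real n) = ln (1 + 1 / real n)"
      using step.hyps by (subst ln_divide_pos[symmetric]) (auto simp: field_simps)
    also have "\<dots> \<le> 1 / real n" by (rule ln_add_one_self_le_self) auto
    finally show ?thesis using step.hyps by (simp add: field_simps)
  qed
  moreover have "ln (fact (Suc n) :: real) = ln (real (Suc n)) + ln (fact n)"
    unfolding fact_Suc by (subst ln_mult_pos) auto
  ultimately show ?case using step.IH by (simp add: algebra_simps)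
qed

text \<open>Mertens' argument: dropping the floors in the expansion of \<open>ln (fact n)\<close>
  only increases it, and Stirling's lower bound divided by \<open>n\<close> gives the claim.\<close>

lemma sum_mangoldt_over_ge:
  assumes "n \<ge> 1" shows "(\<Sum>d=1..n. mangoldt d / real d) \<ge> ln (real n) - 1"
proof -
  have "real n * ln (real n) - real n \<le> (\<Sum>d=1..n. mangoldt d * real (n div d))"
    using ln_fact_ge[OF assms] ln_fact_eq_sum_mangoldt[of n] by simp
  also have "\<dots> \<le> (\<Sum>d=1..n. mangoldt d * (real n / real d))"
    by (intro sum_mono mult_left_mono of_nat_div_le_of_nat mangoldt_nonneg)
  also have "\<dots> = real n * (\<Sum>d=1..n. mangoldt d / real d)"
    by (simp add: sum_distrib_left mult_ac)
  finally have "real n * (ln (real n) - 1) \<le> real n * (\<Sum>d=1..n. mangoldt d / real d)"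
    by (simp add: algebra_simps)
  then show ?thesis using assms by simp
qed

text \<open>The prime powers in \<open>(n - n div 2, n]\<close> contribute to the factorisation of the
  binomial coefficient of \<open>n\<close> over \<open>n div 2\<close>, which is at most \<open>2 ^ n\<close>.\<close>
lemma sum_mangoldt_halving:
  "(\<Sum>d=1..n. mangoldt d) \<le> (\<Sum>d=1..n - n div 2. mangoldt d) + real n * ln 2"
proof -
  define h where "h = n div 2"
  have hn: "h \<le> n - h" "h \<le> n" "n - h \<le> n" by (auto simp: h_def)
  have lf: "ln (fact k :: real) = (\<Sum>d=1..n. mangoldt d * real (k div d))" if "k \<le> n" for k
    unfolding ln_fact_eq_sum_mangoldt using that
    by (intro sum.mono_neutral_left) (auto)
  have "(\<Sum>d\<in>{n-h<..n}. mangoldt d) \<le> (\<Sum>d=1..n. mangoldt d * (real (n div d) - real (h div d) - real ((n - h) div d)))"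
  proof -
    have 1: "(h div d) + ((n - h) div d) \<le> n div d" for d
      using div_add1_eq[of h "n-h" d] hn by simp
    \<comment> \<open>For \<open>d\<close> in the upper half the three floors are 1, 0 and 0, so the
      coefficient is 1.\<close>
    have "(\<Sum>d\<in>{n-h<..n}. mangoldt d) = (\<Sum>d\<in>{n-h<..n}. mangoldt d * (real (n div d) - real (h div d) - real ((n - h) div d)) :: real)"
    proof (intro sum.cong refl)
      fix d assume d: "d \<in> {n-h<..n}"
      then have "n div d \<ge> 1" by (simp add: Suc_le_eq div_greater_zero_iff)
      moreover have "n < 2 * d" using d hn by auto
      then have "n div d < 2" by (simp add: less_mult_imp_div_less)
      ultimately have "n div d = 1" by simp
      moreover have "h div d = 0" "(n - h) div d = 0" using d hn by auto
      ultimately show "mangoldt d = (mangoldt d * (real (n div d) - real (h div d) - real ((n - h) div d)) :: real)"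
        by simp
    qed
    also have "\<dots> \<le> (\<Sum>d=1..n. mangoldt d * (real (n div d) - real (h div d) - real ((n - h) div d)))"
    proof (rule sum_mono2)
      fix d
      have "real (h div d) + real ((n - h) div d) \<le> real (n div d)" using 1[of d] by linarith
      then show "0 \<le> mangoldt d * (real (n div d) - real (h div d) - real ((n - h) div d))"
        by (intro mult_nonneg_nonneg mangoldt_nonneg) auto
    qed auto
    finally show ?thesis .
  qed
  also have "\<dots> = ln (fact n) - ln (fact h) - ln (fact (n - h))"
    using hn by (simp add: lf sum_subtractf sum.distrib algebra_simps)
  also have "\<dots> = ln (real (n choose h))"
    using hn by (simp add: binomial_fact ln_div ln_mult)
  also have "\<dots> \<le> ln (2 ^ n)"
  proof -
    have "n choose h \<le> 2 ^ n" by (rule binomial_le_pow2)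
    then have "real (n choose h) \<le> 2 ^ n" by (metis of_nat_le_iff of_nat_numeral of_nat_power)
    then show ?thesis using hn by (subst ln_le_cancel_iff) auto
  qed
  also have "\<dots> = real n * ln 2" by (simp add: ln_realpow)
  finally have "(\<Sum>d\<in>{n-h<..n}. mangoldt d) \<le> real n * ln 2" .
  moreover have "(\<Sum>d=1..n. mangoldt d) = (\<Sum>d=1..n-h. mangoldt d) + (\<Sum>d\<in>{n-h<..n}. mangoldt d :: real)"
    by (subst sum.union_disjoint[symmetric]) (auto intro!: sum.cong)
  ultimately show ?thesis by (simp add: h_def)
qed

text \<open>Chebyshev's bound by repeated halving: the halved range contributes at most
  \<open>n + 1\<close> and the rest at most \<open>7/10 * n\<close>, together below
  \<open>2 * n\<close> once \<open>n \<ge> 4\<close>.\<close>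

lemma sum_mangoldt_le: "(\<Sum>d=1..n. mangoldt d) \<le> 2 * real n"
proof (induction n rule: less_induct)
  case (less n)
  have m2: "mangoldt 2 = ln (2::real)" using mangoldt_prime[of 2, where ?'a=real] by (simp add: two_is_prime_nat)
  have m3: "mangoldt 3 = ln (3::real)" using mangoldt_prime[of 3, where ?'a=real] by simp
  have l3: "ln (3::real) \<le> 2" using ln_le_minus_one[of "3::real"] by simp
  consider "n = 0" | "n = 1" | "n = 2" | "n = 3" | "n \<ge> 4" by linarith
  then show ?case
  proof cases
    case 5
    have "(\<Sum>d=1..n - n div 2. mangoldt d) \<le> 2 * real (n - n div 2)" using 5 by (intro less) auto
    moreover have "2 * real (n - n div 2) \<le> real n + 1"
    proof -
      have "2 * (n - n div 2) \<le> n + 1" by auto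
      then show ?thesis by linarith
    qed
    moreover have "real n * ln 2 \<le> real n * (7/10)" using ln2_le_seven_tenths by (intro mult_left_mono) auto
    ultimately show ?thesis using sum_mangoldt_halving[of n] 5 by linarith
  qed (use ln2_le_seven_tenths l3 in \<open>auto simp: numeral_2_eq_2 numeral_3_eq_3 m2[unfolded numeral_2_eq_2] m3[unfolded numeral_3_eq_3]\<close>)
qed

section \<open>Characters with bounded partial sums and truncated L-functions at 1\<close>

lemma ln_over_self_antimono:
  assumes "k \<ge> 3" shows "ln (real (Suc k)) / real (Suc k) \<le> ln (real k) / real k"
proof -
  have "ln (real (Suc k)) - ln (real k) = ln (1 + 1 / real k)"
    using assms by (subst ln_divide_pos[symmetric]) (auto simp: field_simps)
  also have "\<dots> \<le> 1 / real k" by (rule ln_add_one_self_le_self) auto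
  finally have "real k * (ln (real (Suc k)) - ln (real k)) \<le> 1" using assms by (simp add: field_simps)
  also have "1 \<le> ln (real k)"
    using one_le_ln3 assms by (rule_tac order_trans[OF one_le_ln3]) auto
  finally have "ln (real (Suc k)) * real k \<le> ln (real k) * real (Suc k)" by (simp add: algebra_simps)
  then show ?thesis using assms by (simp add: divide_simps mult.commute)
qed

text \<open>These are the traits of a nonprincipal Dirichlet character on which Mertens' argument
  rests; bounded partial sums stand in for periodicity and orthogonality. \<open>M_ge_1\<close> lets
  additive constants be absorbed into multiples of \<open>M\<close>.\<close>

locale bounded_character =
  fixes \<eta> :: "nat \<Rightarrow> complex" and M :: real
  assumes mult: "\<And>a b. \<eta> (a * b) = \<eta> a * \<eta> b"
    and norm_le_1: "\<And>a. norm (\<eta> a) \<le> 1"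
    and partial_sum: "\<And>k. norm (\<Sum>i=1..k. \<eta> i) \<le> M"
    and M_ge_1: "1 \<le> M"
begin

lemma interval_sum: assumes "m \<ge> 1" shows "norm (\<Sum>i=m..k. \<eta> i) \<le> 2 * M"
proof (cases "m \<le> k")
  case True
  have "(\<Sum>i=m..k. \<eta> i) = (\<Sum>i=1..k. \<eta> i) - (\<Sum>i=1..m-1. \<eta> i)"
  proof -
    have "{1..k} = {1..m-1} \<union> {m..k}" using assms True by auto
    then show ?thesis by (simp add: sum.union_disjoint)
  qed
  also have "norm \<dots> \<le> M + M" by (rule norm_triangle_le_diff) (use partial_sum add_mono in blast)
  finally show ?thesis by simp
qed (use M_ge_1 in auto)

text \<open>A truncation of the L-series at 1; no limit is taken anywhere.\<close>

definition L :: "nat \<Rightarrow> complex" where "L n = (\<Sum>k=1..n. \<eta> k / of_nat k)"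

lemma L_Suc: "L (Suc n) = L n + \<eta> (Suc n) / of_nat (Suc n)"
  by (simp add: L_def)

lemma norm_L_diff: 
  assumes "K \<le> n" shows "norm (L n - L K) \<le> 2 * M / (real K + 1)"
proof (cases "K < n")
  case True
  have "norm (\<Sum>k=K+1..n. \<eta> k * of_real (1 / real k)) \<le> 2 * M * (1 / real (K+1))"
    using True by (intro norm_sum_mult_antimono_le interval_sum) (auto simp: frac_le)
  moreover have "L n - L K = (\<Sum>k=K+1..n. \<eta> k * of_real (1 / real k))"
  proof -
    have "{1..n} = {1..K} \<union> {K+1..n}" using True by auto
    then show ?thesis by (simp add: L_def sum.union_disjoint)
  qed
  ultimately show ?thesis by (simp add: add.commute)
qed (use assms M_ge_1 in auto)

text \<open>A truncation of the derivative of the L-series. As \<open>ln k / k\<close> decreases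
  only from 3 on, the term at 2 is split off and Abel summation treats the rest;
  \<open>7/20 + 2 * M * (11/30)\<close> is below \<open>11/10 * M\<close>.\<close>

lemma norm_sum_ln:
  "norm (\<Sum>k=1..n. \<eta> k * of_real (ln (real k) / real k)) \<le> 11/10 * M"
proof -
  let ?t = "\<lambda>k. \<eta> k * of_real (ln (real k) / real k)"
  have t2: "norm (?t 2) \<le> 7/20"
  proof -
    have "norm (?t 2) \<le> 1 * (ln 2 / 2)" unfolding norm_mult norm_of_real
      by (intro mult_mono norm_le_1) auto
    then show ?thesis using ln2_le_seven_tenths by simp
  qed
  consider "n = 0" | "n = 1" | "n = 2" | "n \<ge> 3" by linarith
  then show ?thesis
  proof cases
    case 4
    have "norm (\<Sum>k=3..n. ?t k) \<le> 2 * M * (ln (real 3) / real 3)"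
      using 4 by (intro norm_sum_mult_antimono_le interval_sum ln_over_self_antimono) auto
    also have "\<dots> \<le> 2 * M * (11/30)" using ln3_le M_ge_1 by (intro mult_left_mono) auto
    finally have "norm (?t 2 + (\<Sum>k=3..n. ?t k)) \<le> 7/20 + 2 * M * (11/30)"
      using t2 by (intro norm_triangle_mono)
    moreover have "(\<Sum>k=1..n. ?t k) = ?t 2 + (\<Sum>k=3..n. ?t k)"
    proof -
      have "{1..n} = {1,2} \<union> {3..n}" using 4 by auto
      then show ?thesis by (simp add: sum.union_disjoint)
    qed
    ultimately show ?thesis using M_ge_1 by simp
  qed (use t2 M_ge_1 in \<open>auto simp: numeral_2_eq_2\<close>)
qed

text \<open>A finite form of the logarithmic derivative. Expanding \<open>ln k\<close> into
  \<open>mangoldt\<close> gives the sum of \<open>t d * L (n div d)\<close>; replacing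
  \<open>L (n div d)\<close> by \<open>L n\<close> costs at most \<open>4 * M\<close>, after which
  one divides by \<open>L n\<close>.\<close>

lemma norm_sum_mangoldt:
  assumes "n \<ge> 1" "\<delta> > 0" "norm (L n) \<ge> \<delta>"
  shows "norm (\<Sum>d=1..n. \<eta> d * of_real (mangoldt d / real d)) \<le> 51/10 * M / \<delta>"
proof -
  define t where "t = (\<lambda>d. \<eta> d * of_real (mangoldt d / real d))"
  have "(\<Sum>k=1..n. \<eta> k * of_real (ln (real k) / real k))
      = (\<Sum>k=1..n. \<Sum>d | d dvd k. t d * (\<eta> (k div d) / of_nat (k div d)))"
  proof (intro sum.cong refl)
    fix k assume k: "k \<in> {1..n}"
    then have "complex_of_real (ln (real k)) = (\<Sum>d | d dvd k. of_real (mangoldt d))"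
      using mangoldt_sum[of k, where ?'a = complex] by simp
    then have "\<eta> k * of_real (ln (real k) / real k) = (\<Sum>d | d dvd k. \<eta> k * of_real (mangoldt d) / of_nat k)"
      by (simp add: sum_distrib_left sum_divide_distrib)
    also have "\<dots> = (\<Sum>d | d dvd k. t d * (\<eta> (k div d) / of_nat (k div d)))"
    proof (intro sum.cong refl)
      fix d assume "d \<in> {d. d dvd k}"
      then obtain c where c: "k = d * c" by (auto elim: dvdE)
      have "d > 0" using k c by (auto intro!: Nat.gr0I)
      then show "\<eta> k * of_real (mangoldt d) / of_nat k = t d * (\<eta> (k div d) / of_nat (k div d))"
        by (simp add: c t_def mult)
    qed
    finally show "\<eta> k * of_real (ln (real k) / real k) = (\<Sum>d | d dvd k. t d * (\<eta> (k div d) / of_nat (k div d)))" .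
  qed
  also have "\<dots> = (\<Sum>d=1..n. t d * L (n div d))"
    using sum_divisors_eq_sum_hyperbola[of "\<lambda>d j. t d * (\<eta> j / of_nat j)" n] by (simp add: L_def sum_distrib_left)
  finally have eq: "L n * (\<Sum>d=1..n. t d)
      = (\<Sum>k=1..n. \<eta> k * of_real (ln (real k) / real k)) + (\<Sum>d=1..n. t d * (L n - L (n div d)))"
    by (simp add: sum_distrib_left sum_subtractf algebra_simps)
  \<comment> \<open>The tail of the series beyond \<open>n div d\<close> is at most
    \<open>2 * M * d / n\<close>. The factor \<open>d\<close> cancels against
    \<open>mangoldt d / d\<close>, which leaves Chebyshev's sum.\<close>
  have "norm (\<Sum>d=1..n. t d * (L n - L (n div d))) \<le> (\<Sum>d=1..n. 2 * M / real n * mangoldt d)"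
  proof (rule sum_norm_le)
    fix d assume d: "d \<in> {1..n}"
    have "norm (t d) \<le> 1 * (mangoldt d / real d)"
      unfolding t_def norm_mult norm_of_real by (intro mult_mono norm_le_1) (auto simp: mangoldt_nonneg)
    moreover have "norm (L n - L (n div d)) \<le> 2 * M * real d / real n"
    proof -
      have "n < d * (n div d + 1)"
        using d mod_less_divisor[of d n] mult_div_mod_eq[of d n] 
        by (simp only: distrib_left mult_1_right atLeastAtMost_iff) linarith
      then have "real n \<le> real (d * (n div d + 1))" by linarith
      then have "real n \<le> real d * (real (n div d) + 1)" by (simp add: algebra_simps)
      then have "2 * M / (real (n div d) + 1) \<le> 2 * M * real d / real n"
        using d M_ge_1 mult_left_mono[of "real n" "real d * (real (n div d) + 1)" "2 * M"]
        by (simp add: pos_divide_le_eq pos_le_divide_eq mult_ac)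
      then show ?thesis using norm_L_diff[of "n div d" n] by simp
    qed
    ultimately have "norm (t d * (L n - L (n div d))) \<le> (1 * (mangoldt d / real d)) * (2 * M * real d / real n)"
      unfolding norm_mult by (intro mult_mono) (auto simp: mangoldt_nonneg)
    also have "\<dots> = 2 * M / real n * mangoldt d" using d by (simp add: field_simps)
    finally show "norm (t d * (L n - L (n div d))) \<le> 2 * M / real n * mangoldt d" .
  qed
  also have "\<dots> = 2 * M / real n * (\<Sum>d=1..n. mangoldt d)" by (simp add: sum_distrib_left)
  also have "\<dots> \<le> 2 * M / real n * (2 * real n)"
    using M_ge_1 by (intro mult_left_mono sum_mangoldt_le) auto
  also have "\<dots> = 4 * M" using assms by simp
  finally have "norm (L n * (\<Sum>d=1..n. t d)) \<le> 11/10 * M + 4 * M"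
    unfolding eq by (intro norm_triangle_mono norm_sum_ln)
  moreover have "\<delta> * norm (\<Sum>d=1..n. t d) \<le> norm (L n * (\<Sum>d=1..n. t d))"
    unfolding norm_mult by (intro mult_right_mono assms) auto
  ultimately have "\<delta> * norm (\<Sum>d=1..n. t d) \<le> 51/10 * M" by linarith
  then show ?thesis using assms(2) by (simp add: t_def field_simps)
qed

end

section \<open>The contribution of proper prime powers\<close>

lemma sum_ln_over_pronic_le: 
  "(\<Sum>k=2..n. ln (real k) / (real k * (real k - 1))) \<le> 2"
proof (cases "n = 0")
  case False
  then have "n \<ge> 1" by simp
  \<comment> \<open>The correction term is modelled on the tail integral of
    \<open>ln x / x^2\<close>; it makes the induction telescope and equals 2 at
    \<open>n = 1\<close>.\<close>
  then have "(\<Sum>k=2..n. ln (real k) / (real k * (real k - 1))) \<le> 2 - (ln (real n) + 2) / real n"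
  proof (induction n rule: dec_induct)
    case base
    show ?case by simp
  next
    case (step n)
    have n: "real n > 0" using step.hyps by simp
    have "ln (real (Suc n)) - ln (real n) = ln (1 + 1 / real n)"
      using n by (subst ln_divide_pos[symmetric]) (auto simp: field_simps)
    also have "\<dots> \<le> 1 / real n" by (rule ln_add_one_self_le_self) auto
    finally have "real (Suc n) * (ln (real (Suc n)) - ln (real n)) \<le> real (Suc n) * (1 / real n)"
      by (intro mult_left_mono) auto
    also have "\<dots> \<le> 2" using step.hyps by (simp add: field_simps)
    finally have "real n * ln (real (Suc n)) + ln (real (Suc n)) \<le> real (Suc n) * ln (real n) + 2"
      by (simp add: algebra_simps)
    then have "ln (real (Suc n)) / (real (Suc n) * real n) 
        \<le> (ln (real n) + 2) / real n - (ln (real (Suc n)) + 2) / real (Suc n)"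
      using n by (simp add: divide_simps) (simp add: algebra_simps)
    then show ?case using step.IH step.hyps by simp
  qed
  moreover have "0 \<le> (ln (real n) + 2) / real n" using False by simp
  ultimately show ?thesis by linarith
qed auto

text \<open>Only \<open>p ^ k\<close> with \<open>k \<ge> 2\<close> contributes. The geometric
  series over \<open>k\<close> gives \<open>ln p / (p * (p - 1))\<close>, and the sum over primes is
  then enlarged to all integers from 2 on.\<close>

lemma sum_mangoldt_nonprime_le:
  "(\<Sum>d | d \<in> {1..n} \<and> \<not> prime d. mangoldt d / real d) \<le> 2"
proof -
  define D where "D = {d \<in> {1..n}. \<not> prime d \<and> primepow d}"
  define X where "X = {p \<in> {2..n}. prime p}"
  have sub: "D \<subseteq> (\<lambda>(p, k). p ^ k) ` (X \<times> {2..n})"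
  proof
    fix d assume d: "d \<in> D"
    then obtain p k where pk: "prime p" "k > 0" "d = p ^ k" by (auto simp: D_def primepow_def)
    have "k \<noteq> 1" using d pk by (auto simp: D_def)
    then have "k \<ge> 2" using pk by simp
    moreover have "p \<le> d" using pk by (simp add: self_le_power prime_gt_0_nat Suc_le_eq)
    moreover have "k < d" using pk by (metis less_exp less_le_trans power_mono prime_ge_2_nat le0)
    ultimately have "(p, k) \<in> X \<times> {2..n}" using pk d prime_ge_2_nat[of p] by (auto simp: X_def D_def)
    then show "d \<in> (\<lambda>(p, k). p ^ k) ` (X \<times> {2..n})" using pk by force
  qed
  have "(\<Sum>d | d \<in> {1..n} \<and> \<not> prime d. mangoldt d / real d) = (\<Sum>d\<in>D. mangoldt d / real d)"
    by (rule sum.mono_neutral_right) (auto simp: D_def mangoldt_def)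
  also have "\<dots> \<le> (\<Sum>d\<in>(\<lambda>(p, k). p ^ k) ` (X \<times> {2..n}). mangoldt d / real d)"
    by (intro sum_mono2 sub) (auto simp: X_def mangoldt_nonneg)
  \<comment> \<open>The terms are nonnegative, so passing from the image to the pairs can only
    increase the sum; this avoids an appeal to unique factorisation.\<close>
  also have "\<dots> \<le> sum ((\<lambda>d. mangoldt d / real d) \<circ> (\<lambda>(p, k). p ^ k)) (X \<times> {2..n})"
    by (rule sum_image_le) (auto simp: X_def mangoldt_nonneg)
  also have "\<dots> = (\<Sum>p\<in>X. \<Sum>k=2..n. ln (real p) / real p ^ k)"
    unfolding sum.cartesian_product by (intro sum.cong) (auto simp: X_def)
  also have "\<dots> \<le> (\<Sum>p\<in>X. ln (real p) / (real p * (real p - 1)))"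
  proof (rule sum_mono)
    fix p assume "p \<in> X"
    then have p: "real p \<ge> 2" by (auto simp: X_def)
    have "(\<Sum>k=2..m. 1 / real p ^ k) \<le> 1 / (real p * (real p - 1)) - 1 / (real p ^ m * (real p - 1))" if "m \<ge> 1" for m
      using that
    proof (induction m rule: dec_induct)
      case (step m)
      have "1 / real p ^ Suc m = 1 / (real p ^ m * (real p - 1)) - 1 / (real p ^ Suc m * (real p - 1))"
      proof -
        have "1 / (q * (p' - 1)) - 1 / (p' * q * (p' - 1)) = 1 / (p' * q)" if "p' \<ge> 2" "q > 0" for p' q :: real
          using that by (simp add: divide_simps)
        from this[OF p, of "real p ^ m"] p show ?thesis by simp
      qed
      then show ?case using step by simp
    qed simp
    moreover have "n \<ge> 1" using \<open>p \<in> X\<close> by (auto simp: X_def)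
    moreover have "0 \<le> 1 / (real p ^ n * (real p - 1))" using p by simp
    ultimately have "(\<Sum>k=2..n. 1 / real p ^ k) \<le> 1 / (real p * (real p - 1))" by (smt (verit))
    then have "ln (real p) * (\<Sum>k=2..n. 1 / real p ^ k) \<le> ln (real p) * (1 / (real p * (real p - 1)))"
      using p by (intro mult_left_mono) auto
    then show "(\<Sum>k=2..n. ln (real p) / real p ^ k) \<le> ln (real p) / (real p * (real p - 1))"
      by (simp add: sum_distrib_left)
  qed
  also have "\<dots> \<le> (\<Sum>k=2..n. ln (real k) / (real k * (real k - 1)))"
    by (rule sum_mono2) (auto simp: X_def)
  also have "\<dots> \<le> 2" by (rule sum_ln_over_pronic_le)
  finally show ?thesis .
qed

section \<open>Nonprincipal characters modulo 3 and 5, with their L-series bounded away from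
  0\<close>

definition char3 :: "nat \<Rightarrow> complex" where
  "char3 n = (if n mod 3 = 1 then 1 else if n mod 3 = 2 then - 1 else 0)"

text \<open>The character of order four that sends the primitive root 2 to \<open>\<i>\<close>. Its
  square is the quadratic character and its conjugate is the remaining nonprincipal one.\<close>

definition char5 :: "nat \<Rightarrow> complex" where
  "char5 n = (if n mod 5 = 1 then 1 else if n mod 5 = 2 then \<i> else
     if n mod 5 = 3 then - \<i> else if n mod 5 = 4 then - 1 else 0)"

lemma mod3_cases: obtains "n mod 3 = 0" | "n mod 3 = 1" | "n mod 3 = (2::nat)"
  by linarith

lemma mod5_cases:
  obtains "n mod 5 = 0" | "n mod 5 = 1" | "n mod 5 = 2" | "n mod 5 = 3" | "n mod 5 = (4::nat)"
  by linarith

lemma char3_mult: "char3 (a * b) = char3 a * char3 b"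
proof -
  have "(a * b) mod 3 = (a mod 3) * (b mod 3) mod 3" by (simp add: mod_mult_eq)
  then show ?thesis
    by (cases a rule: mod3_cases; cases b rule: mod3_cases) (simp_all add: char3_def)
qed

lemma char5_mult: "char5 (a * b) = char5 a * char5 b"
proof -
  have "(a * b) mod 5 = (a mod 5) * (b mod 5) mod 5" by (simp add: mod_mult_eq)
  then show ?thesis
    by (cases a rule: mod5_cases; cases b rule: mod5_cases) (simp_all add: char5_def)
qed

lemma sum_char3: "(\<Sum>i=1..k. char3 i) = (if k mod 3 = 1 then 1 else 0)"
  by (induction k) (auto simp: char3_def mod_Suc)

lemma sum_char5: "(\<Sum>i=1..k. char5 i) = 
    (if k mod 5 = 1 \<or> k mod 5 = 3 then 1 else if k mod 5 = 2 then 1 + \<i> else 0)"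
proof (induction k)
  case (Suc k)
  then show ?case by (cases k rule: mod5_cases) (simp_all add: char5_def mod_Suc)
qed simp

lemma sum_char5_square: "(\<Sum>i=1..k. char5 i ^ 2) = 
    (if k mod 5 = 1 then 1 else if k mod 5 = 3 then - 1 else 0)"
proof (induction k)
  case (Suc k)
  then show ?case by (cases k rule: mod5_cases) (simp_all add: char5_def mod_Suc)
qed simp

interpretation c3: bounded_character char3 1
proof
  show "norm (\<Sum>i=1..k. char3 i) \<le> 1" for k unfolding sum_char3 by simp
qed (simp_all add: char3_mult, simp add: char3_def)

interpretation c5: bounded_character char5 "3/2"
proof
  have "norm (1 + \<i>) = sqrt 2" by (simp add: cmod_def)
  also have "\<dots> \<le> 3/2" by (rule real_le_lsqrt) (auto simp: power2_eq_square)
  finally show "norm (\<Sum>i=1..k. char5 i) \<le> 3/2" for k unfolding sum_char5 by simp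
qed (simp_all add: char5_mult, simp add: char5_def)

interpretation c5sq: bounded_character "\<lambda>n. char5 n ^ 2" 1
proof
  show "norm (\<Sum>i=1..k. char5 i ^ 2) \<le> 1" for k unfolding sum_char5_square by simp
qed (simp_all add: char5_mult power_mult_distrib, simp add: char5_def)

text \<open>Complete periods add \<open>1 / (3 * k + 1) - 1 / (3 * k + 2) \<ge> 0\<close>, so the
  first one, \<open>1 - 1/2\<close>, is a lower bound.\<close>

lemma norm_L_char3: assumes "k \<ge> 1" shows "norm (c3.L (3 * k)) \<ge> 1/2"
proof -
  have "Re (c3.L (3 * k)) \<ge> 1/2" using assms
  proof (induction k rule: dec_induct)
    case base
    have "{1..3} = {1, 2, 3::nat}" by auto
    then show ?case by (simp add: c3.L_def) (simp add: char3_def)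
  next
    case (step k)
    have r:  "Suc (3 * k) mod 3 = 1" "Suc (Suc (3 * k)) mod 3 = 2" "Suc (Suc (Suc (3 * k))) mod 3 = 0"
      by presburger+
    have "3 * Suc k = Suc (Suc (Suc (3 * k)))" by simp
    then have "c3.L (3 * Suc k) = c3.L (3 * k) + 1 / of_nat (Suc (3 * k)) + (- 1) / of_nat (Suc (Suc (3 * k)))"
      by (simp only: c3.L_Suc) (simp add: char3_def r del: of_nat_Suc)
    then have "Re (c3.L (3 * Suc k)) = Re (c3.L (3 * k)) + (1 / (3 * real k + 1) - 1 / (3 * real k + 2))"
      by (simp add: Re_divide_of_nat del: of_nat_Suc) (simp add: add_ac)
    moreover have "1 / (3 * real k + 2) \<le> 1 / (3 * real k + 1)" by (intro divide_left_mono) auto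
    ultimately show ?case using step.IH by linarith
  qed
  then show ?thesis by (rule order_trans[OF _ complex_Re_le_cmod])
qed

text \<open>Only the residues 1 and 4 enter the real part; every period adds a nonnegative amount
  and the first gives \<open>1 - 1/4\<close>.\<close>

lemma norm_L_char5: assumes "k \<ge> 1" shows "norm (c5.L (5 * k)) \<ge> 3/4"
proof -
  have "Re (c5.L (5 * k)) \<ge> 3/4" using assms
  proof (induction k rule: dec_induct)
    case base
    have "{1..5} = {1, 2, 3, 4, 5::nat}" by auto
    then show ?case by (simp add: c5.L_def) (simp add: char5_def)
  next
    case (step k)
    have r:  "Suc (5 * k) mod 5 = 1" "Suc (Suc (5 * k)) mod 5 = 2" "Suc (Suc (Suc (5 * k))) mod 5 = 3" "Suc (Suc (Suc (Suc (5 * k)))) mod 5 = 4" "Suc (Suc (Suc (Suc (Suc (5 * k))))) mod 5 = 0"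
      by presburger+
    have "5 * Suc k = Suc (Suc (Suc (Suc (Suc (5 * k)))))" by simp
    then have "c5.L (5 * Suc k) = c5.L (5 * k) + 1 / of_nat (Suc (5 * k)) + \<i> / of_nat (Suc (Suc (5 * k))) + (- \<i>) / of_nat (Suc (Suc (Suc (5 * k)))) + (- 1) / of_nat (Suc (Suc (Suc (Suc (5 * k)))))"
      by (simp only: c5.L_Suc) (simp add: char5_def r del: of_nat_Suc)
    then have "Re (c5.L (5 * Suc k)) = Re (c5.L (5 * k)) + (1 / (5 * real k + 1) - 1 / (5 * real k + 4))"
      by (simp add: Re_divide_of_nat del: of_nat_Suc) (simp add: add_ac)
    moreover have "1 / (5 * real k + 4) \<le> 1 / (5 * real k + 1)" by (intro divide_left_mono) auto
    ultimately show ?case using step.IH by linarith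
  qed
  then show ?thesis by (rule order_trans[OF _ complex_Re_le_cmod])
qed

text \<open>The first period gives \<open>1 - 1/2 - 1/3 + 1/4\<close>, and the later ones are
  nonnegative by convexity of \<open>1 / x\<close>.\<close>

lemma norm_L_char5_square: assumes "k \<ge> 1" shows "norm (c5sq.L (5 * k)) \<ge> 5/12"
proof -
  have "Re (c5sq.L (5 * k)) \<ge> 5/12" using assms
  proof (induction k rule: dec_induct)
    case base
    have "{1..5} = {1, 2, 3, 4, 5::nat}" by auto
    then show ?case by (simp add: c5sq.L_def) (simp add: char5_def)
  next
    case (step k)
    have r:  "Suc (5 * k) mod 5 = 1" "Suc (Suc (5 * k)) mod 5 = 2" "Suc (Suc (Suc (5 * k))) mod 5 = 3" "Suc (Suc (Suc (Suc (5 * k)))) mod 5 = 4" "Suc (Suc (Suc (Suc (Suc (5 * k))))) mod 5 = 0"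
      by presburger+
    have "5 * Suc k = Suc (Suc (Suc (Suc (Suc (5 * k)))))" by simp
    then have "c5sq.L (5 * Suc k) = c5sq.L (5 * k) + 1 / of_nat (Suc (5 * k)) + (- 1) / of_nat (Suc (Suc (5 * k))) + (- 1) / of_nat (Suc (Suc (Suc (5 * k)))) + 1 / of_nat (Suc (Suc (Suc (Suc (5 * k)))))"
      by (simp only: c5sq.L_Suc) (simp add: char5_def r del: of_nat_Suc)
    then have "Re (c5sq.L (5 * Suc k)) = Re (c5sq.L (5 * k)) + (1 / (5 * real k + 1) 
        - 1 / (5 * real k + 2) - 1 / (5 * real k + 3) + 1 / (5 * real k + 4))"
      by (simp add: Re_divide_of_nat del: of_nat_Suc) (simp add: add_ac)
    moreover have "1 / (x + 2) + 1 / (x + 3) \<le> 1 / (x + 1) + 1 / (x + 4)" if "x \<ge> 0" for x :: real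
    proof -
      have "1 / (x + 1) + 1 / (x + 4) - (1 / (x + 2) + 1 / (x + 3))
          = (4 * x + 10) / ((x + 1) * (x + 2) * (x + 3) * (x + 4))"
        using that by (simp add: divide_simps) (simp add: algebra_simps)
      also have "\<dots> \<ge> 0" using that by simp
      finally show ?thesis by simp
    qed
    from this[of "5 * real k"] 
    have "1 / (5 * real k + 2) + 1 / (5 * real k + 3) \<le> 1 / (5 * real k + 1) + 1 / (5 * real k + 4)" by simp
    ultimately show ?case using step.IH by linarith
  qed
  then show ?thesis by (rule order_trans[OF _ complex_Re_le_cmod])
qed


section \<open>Mertens sums over primes weighted by the sieve dimension\<close>

lemma uminus_le_Re: "norm z \<le> B \<Longrightarrow> - B \<le> Re z"
  using abs_Re_le_cmod[of z] by linarith

text \<open>The number of residue classes modulo \<open>r\<close> that are sifted out: 0 and, if \<open>r\<close> is 1 modulo \<open>l\<close>,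
  the \<open>l - 1\<close> primitive \<open>l\<close>-th roots of unity.\<close>
definition sieve_dim :: "nat \<Rightarrow> nat \<Rightarrow> nat" where
  "sieve_dim l r = (if r mod l = 1 then l else 1)"

text \<open>With weight 2 at the multiples of \<open>l\<close>, the weight minus 2 is a combination
  of nonprincipal characters, whose sums are bounded. Taking \<open>n\<close> to be a multiple of
  \<open>l\<close> makes the lower bounds for \<open>L n\<close> applicable.\<close>

lemma sum_sieve_dim_ge_of_mult:
  assumes "l = 3 \<or> l = 5" "l dvd n" "n \<ge> 1"
  shows "(\<Sum>d=1..n. (if l dvd d then 2 else real (sieve_dim l d)) * (mangoldt d / real d)) \<ge> 2 * ln (real n) - 35"
proof -
  define t :: "nat \<Rightarrow> real" where "t = (\<lambda>d. mangoldt d / real d)"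
  have t: "(\<Sum>d=1..n. t d) \<ge> ln (real n) - 1" 
    unfolding t_def by (rule sum_mangoldt_over_ge) fact
  obtain k where k: "n = l * k" "k \<ge> 1" using assms by (auto elim!: dvdE simp: Suc_le_eq)
  from assms(1) show ?thesis
  proof
    assume l: "l = 3"
    have *: "Re (char3 d) = (if 3 dvd d then 2 else real (sieve_dim 3 d)) - 2" for d
      by (cases d rule: mod3_cases) (auto simp: sieve_dim_def char3_def dvd_eq_mod_eq_0)
    have "norm (\<Sum>d=1..n. char3 d * of_real (t d)) \<le> 51/10 * 1 / (1/2)"
      unfolding t_def using k l norm_L_char3[of k] by (intro c3.norm_sum_mangoldt) auto
    from uminus_le_Re[OF this] have "(\<Sum>d=1..n. Re (char3 d) * t d) \<ge> - 51/5" by simp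
    then have "(\<Sum>d=1..n. (if 3 dvd d then 2 else real (sieve_dim 3 d)) * t d) - 2 * (\<Sum>d=1..n. t d) \<ge> - 51/5"
      unfolding * by (simp add: left_diff_distrib sum_subtractf sum_distrib_left)
    then show ?thesis using t unfolding l t_def by linarith
  next
    assume l: "l = 5"
    \<comment> \<open>The two conjugate quartic characters together give
      \<open>2 * Re (char5 d)\<close>. The errors below, \<open>306/25 + 102/5 + 2\<close>, stay
      under 35.\<close>
    have *: "Re (char5 d ^ 2) + 2 * Re (char5 d) = (if 5 dvd d then 2 else real (sieve_dim 5 d)) - 2" for d
      by (cases d rule: mod5_cases) (auto simp: sieve_dim_def char5_def dvd_eq_mod_eq_0)
    have "norm (\<Sum>d=1..n. char5 d * of_real (t d)) \<le> 51/10 * (3/2) / (3/4)"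
      unfolding t_def using k l norm_L_char5[of k] by (intro c5.norm_sum_mangoldt) auto
    from uminus_le_Re[OF this] have 1: "(\<Sum>d=1..n. Re (char5 d) * t d) \<ge> - 51/5" by simp
    have "norm (\<Sum>d=1..n. char5 d ^ 2 * of_real (t d)) \<le> 51/10 * 1 / (5/12)"
      unfolding t_def using k l norm_L_char5_square[of k] by (intro c5sq.norm_sum_mangoldt) auto
    from uminus_le_Re[OF this] have 2: "(\<Sum>d=1..n. Re (char5 d ^ 2) * t d) \<ge> - 306/25" by simp
    have "(\<Sum>d=1..n. (Re (char5 d ^ 2) + 2 * Re (char5 d)) * t d) \<ge> - 306/25 - 102/5"
      using 1 2 by (simp add: distrib_right sum.distrib sum_distrib_left[symmetric] mult.assoc)
    then have "(\<Sum>d=1..n. (if 5 dvd d then 2 else real (sieve_dim 5 d)) * t d) - 2 * (\<Sum>d=1..n. t d) \<ge> - 306/25 - 102/5"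
      unfolding * by (simp add: left_diff_distrib sum_subtractf sum_distrib_left)
    then show ?thesis using t unfolding l t_def by linarith
  qed
qed

text \<open>The constant 48 collects 35, a loss of \<open>2 * 7/10\<close> from rounding
  \<open>n\<close> down to a multiple of \<open>l\<close>, at most \<open>5 * 2\<close> for proper
  prime powers, and at most 1 because the prime \<open>l\<close> had weight 2 instead of 1.\<close>

lemma sum_primes_sieve_dim_ge:
  assumes "l = 3 \<or> l = 5" "n \<ge> 1"
  shows "(\<Sum>r | prime r \<and> r \<le> n. real (sieve_dim l r) * ln (real r) / real r) \<ge> 2 * ln (real n) - 48"
proof -
  let ?w = "\<lambda>d. if l dvd d then 2 else real (sieve_dim l d)"
  let ?t = "\<lambda>d::nat. mangoldt d / real d :: real"
  let ?a = "\<lambda>r. real (sieve_dim l r) * ln (real r) / real r"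
  have l: "prime l" using assms by (auto intro: prime_nat_numeral_eq)
  have nn: "0 \<le> ?a r" for r by (cases "r = 0") auto
  have le3: "ln (real l) \<le> 3"
    \<comment> \<open>\<open>ln 5 = ln (5/2) + ln 2 \<le> 3/2 + 7/10\<close>.\<close>
    using assms(1) ln3_le ln_le_minus_one[of "5/2::real"] ln2_le_seven_tenths ln_mult_pos[of "5/2" "2::real"] by auto
  show ?thesis
  proof (cases "n < l")
    case True
    then have "ln (real n) \<le> ln (real l)" using assms by simp
    then have "2 * ln (real n) - 48 \<le> 0" using le3 by simp
    moreover have "0 \<le> (\<Sum>r | prime r \<and> r \<le> n. ?a r)" by (intro sum_nonneg nn)
    ultimately show ?thesis by linarith
  next
    case False
    define m where "m = l * (n div l)"
    have m: "l dvd m" "m \<le> n" "m \<ge> 1" "n \<le> 2 * m"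
    proof -
      have "n mod l < l" using l prime_gt_0_nat by simp
      moreover have "n = m + n mod l" by (simp add: m_def)
      moreover have "l \<le> m" using False l prime_gt_0_nat[of l] by (simp add: m_def Suc_le_eq div_greater_zero_iff)
      ultimately show "m \<le> n" "m \<ge> 1" "n \<le> 2 * m"
        using prime_gt_0_nat[OF l] by linarith+
      show "l dvd m" by (simp add: m_def)
    qed
    have "ln (real n) \<le> ln (2 * real m)" using m by (subst ln_le_cancel_iff) auto
    also have "\<dots> \<le> ln (real m) + 7/10" using m ln2_le_seven_tenths by (subst ln_mult_pos) auto
    finally have lnm: "ln (real n) \<le> ln (real m) + 7/10" .
    have "2 * ln (real m) - 35 \<le> (\<Sum>d=1..m. ?w d * ?t d)"
      by (rule sum_sieve_dim_ge_of_mult) (use assms m in auto)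
    also have "\<dots> = (\<Sum>d | d \<in> {1..m} \<and> prime d. ?w d * ?t d) + (\<Sum>d | d \<in> {1..m} \<and> \<not> prime d. ?w d * ?t d)"
      by (subst sum.union_disjoint[symmetric]) (auto intro!: sum.cong)
    also have "(\<Sum>d | d \<in> {1..m} \<and> \<not> prime d. ?w d * ?t d) \<le> (\<Sum>d | d \<in> {1..m} \<and> \<not> prime d. 5 * ?t d)"
      using assms(1) by (intro sum_mono mult_right_mono) (auto simp: sieve_dim_def mangoldt_nonneg)
    also have "\<dots> = 5 * (\<Sum>d | d \<in> {1..m} \<and> \<not> prime d. ?t d)" by (simp add: sum_distrib_left)
    also have "\<dots> \<le> 5 * 2" by (intro mult_left_mono sum_mangoldt_nonprime_le) auto
    also have "(\<Sum>d | d \<in> {1..m} \<and> prime d. ?w d * ?t d) \<le> (\<Sum>d | d \<in> {1..m} \<and> prime d. ?a d + (if d = l then ?t l else 0))"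
    proof (rule sum_mono)
      fix d assume "d \<in> {d \<in> {1..m}. prime d}"
      then have d: "prime d" by simp
      then show "?w d * ?t d \<le> ?a d + (if d = l then ?t l else 0)"
        using l primes_dvd_imp_eq[OF l d] prime_gt_1_nat[OF l]
        by (auto simp: sieve_dim_def)
    qed
    also have "\<dots> \<le> (\<Sum>d | d \<in> {1..m} \<and> prime d. ?a d) + ?t l"
      by (auto simp: sum.distrib sum.delta mangoldt_nonneg)
    also have "(\<Sum>d | d \<in> {1..m} \<and> prime d. ?a d) \<le> (\<Sum>r | prime r \<and> r \<le> n. ?a r)"
      using m nn by (intro sum_mono2) auto
    also have "?t l \<le> 1"
      using l le3 assms(1) by auto
    finally show ?thesis using lnm by linarith
  qed
qed

text \<open>Partial summation removes the factor \<open>ln r\<close>; it is carried out as an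
  induction on \<open>n\<close> that starts at \<open>2 ^ 33\<close>.\<close>

lemma sum_primes_sieve_dim_over_ge:
  assumes l: "l = 3 \<or> l = 5" and n: "n \<ge> 2 ^ 33"
  shows "(\<Sum>r | prime r \<and> r \<le> n. real (sieve_dim l r) / real r) \<ge> 2 * ln (ln (real n)) - 33/5"
proof -
  define P where "P = (\<lambda>n::nat. {r::nat. prime r \<and> r \<le> n})"
  define G where "G = (\<lambda>n. \<Sum>r\<in>P n. real (sieve_dim l r) * ln (real r) / real r)"
  define S where "S = (\<lambda>n. \<Sum>r\<in>P n. real (sieve_dim l r) / real r)"
  \<comment> \<open>The loss \<open>2 * ln x + 49 / x\<close> with \<open>x = ln w\<close> is least
    at \<open>x = 49/2\<close>; this \<open>w\<close> comes close.\<close>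
  define w :: nat where "w = 2 ^ 33"
  have lnw: "ln (real w) = 33 * ln 2" using ln_realpow[of 2 33]
    by (simp only: w_def of_nat_power of_nat_numeral)
  have w2: "real w \<ge> 2" by (simp add: w_def)
  have PS: "P (Suc n) = (if prime (Suc n) then insert (Suc n) (P n) else P n)" for n
    by (auto simp: P_def le_Suc_eq)
  have fin: "finite (P n)" "Suc n \<notin> P n" for n by (auto simp: P_def)
  \<comment> \<open>\<open>G n / ln n\<close> is the boundary term: a new prime \<open>n + 1\<close>
    raises \<open>S\<close> and \<open>G / ln (n + 1)\<close> by the same amount.\<close>
  have "S n \<ge> G n / ln (real n) + 2 * ln (ln (real n)) - 2 * ln (ln (real w))
           - 49 * (1 / ln (real w) - 1 / ln (real n))"
    using n unfolding w_def[symmetric]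
  proof (induction n rule: dec_induct)
    case base
    have "G w / ln (real w) \<le> S w"
      unfolding G_def S_def sum_divide_distrib
    proof (rule sum_mono)
      fix r assume "r \<in> P w"
      then have r: "r \<ge> 2" "r \<le> w" by (auto simp: P_def prime_ge_2_nat)
      then have "ln (real r) / ln (real w) \<le> 1" using w2 by simp
      then have "(real (sieve_dim l r) / real r) * (ln (real r) / ln (real w)) \<le> (real (sieve_dim l r) / real r) * 1"
        by (intro mult_left_mono) auto
      then show "real (sieve_dim l r) * ln (real r) / real r / ln (real w) \<le> real (sieve_dim l r) / real r"
        by (simp add: field_simps)
    qed
    then show ?case by simp
  next
    case (step n)
    define x where "x = ln (real n)" 
    define y where "y = ln (real (Suc n))"
    have n2: "real n \<ge> 2" using w2 step.hyps by (meson of_nat_mono order_trans)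
    have x0: "x > 0" using n2 by (simp add: x_def)
    have xy: "x \<le> y" using n2 by (simp add: x_def y_def)
    have y0: "y > 0" using x0 xy by simp
    have "y - x = ln (1 + 1 / real n)"
      using n2 unfolding x_def y_def by (subst ln_divide_pos[symmetric]) (auto simp: field_simps)
    also have "\<dots> \<le> 1 / real n" by (rule ln_add_one_self_le_self) auto
    also have "\<dots> \<le> 1/2" using n2 by (simp add: field_simps)
    finally have yx: "y - x \<le> 1/2" .
    \<comment> \<open>Moving from \<open>ln n\<close> to \<open>ln (n + 1)\<close> costs at most
      \<open>2 * 1/2\<close>, which turns 48 into 49.\<close>
    have Gn: "G n \<ge> 2 * y - 49"
      using sum_primes_sieve_dim_ge[OF l, of n] n2 yx unfolding G_def P_def x_def by simp
    have "1 / x - 1 / y \<ge> 0" using x0 xy by (simp add: frac_le)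
    then have *: "(2 * y - 49) * (1 / x - 1 / y) \<le> G n * (1 / x - 1 / y)"
      using Gn by (rule mult_right_mono[rotated])
    have "ln y - ln x \<le> y / x - 1"
      using x0 y0 ln_le_minus_one[of "y / x"] by (simp add: ln_div)
    then have "2 * (ln y - ln x) - 49 * (1 / x - 1 / y) \<le> 2 * (y / x - 1) - 49 * (1 / x - 1 / y)"
      by simp
    also have "\<dots> = (2 * y - 49) * (1 / x - 1 / y)"
      using x0 y0 by (simp add: field_simps)
    also note *
    also have "G n * (1 / x - 1 / y) = G n / x - G n / y"
      by (simp add: right_diff_distrib)
    finally have key: "2 * (ln y - ln x) - 49 * (1 / x - 1 / y) \<le> G n / x - G n / y" .
    have "S (Suc n) - G (Suc n) / y = S n - G n / y"
      using fin[of n] y0 by (simp add: S_def G_def PS y_def add_divide_distrib)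
    then show ?case using step.IH key unfolding x_def[symmetric] y_def[symmetric]
      by (simp add: algebra_simps)
  qed
  moreover have "G n / ln (real n) \<ge> 2 - 48 * (1 / ln (real n))"
  proof -
    have "n \<ge> 2" using n by simp
    then have "ln (real n) > 0" by simp
    then have "(2 * ln (real n) - 48) / ln (real n) \<le> G n / ln (real n)"
      using sum_primes_sieve_dim_ge[OF l, of n] n unfolding G_def P_def by (intro divide_right_mono) auto
    then show ?thesis using \<open>ln (real n) > 0\<close> by (simp add: diff_divide_distrib)
  qed
  moreover have "1 / ln (real n) \<ge> 0" using n by simp
  moreover have "ln (ln (real w)) \<le> 3 * (25/36) + 11/10"
  proof -
    \<comment> \<open>\<open>33 * 25/36\<close> is below 24, whose logarithm is controlled by those
      of 2 and 3.\<close>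
    have "ln (ln (real w)) \<le> ln (2 ^ 3 * 3 :: real)"
      unfolding lnw using ln2_le_25_over_36 by (subst ln_le_cancel_iff) auto
    also have "\<dots> = 3 * ln 2 + ln 3" using ln_realpow[of 2 3] by (subst ln_mult_pos) auto
    also have "\<dots> \<le> 3 * (25/36) + 11/10" using ln3_le ln2_le_25_over_36 by simp
    finally show ?thesis .
  qed
  moreover have "1 / ln (real w) \<le> 1/22"
    unfolding lnw using ln2_ge_two_thirds by (intro divide_left_mono) auto
  ultimately have "2 * ln (ln (real n)) - 33/5 \<le> S n"
    unfolding right_diff_distrib by linarith
  then show ?thesis unfolding S_def P_def .
qed

section \<open>Brun's sieve\<close>

text \<open>The right-hand side is the ceiling of \<open>(N - c) / q\<close>, arranged so that the
  subtraction never truncates.\<close>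

lemma card_residue_class_lessThan:
  fixes c q :: nat assumes "c < q"
  shows "card {n \<in> {..<N}. n mod q = c} = (N + q - 1 - c) div q"
proof (induction N)
  case 0
  then show ?case using assms by simp
next
  case (Suc N)
  have eq: "{n \<in> {..<Suc N}. n mod q = c} = (if N mod q = c then insert N {n \<in> {..<N}. n mod q = c} else {n \<in> {..<N}. n mod q = c})"
    by (auto simp: less_Suc_eq)
  have "Suc N + q - 1 - c = Suc (N + q - 1 - c)" using assms by simp
  moreover have "Suc (N + q - 1 - c) mod q = 0 \<longleftrightarrow> N mod q = c"
  proof -
    have "Suc (N + q - 1 - c) = N + (q - c)" using assms by simp
    moreover have "(N + (q - c)) mod q = (N mod q + (q - c)) mod q" by (simp add: mod_add_left_eq)
    moreover have "(N mod q + (q - c)) mod q = 0 \<longleftrightarrow> N mod q = c"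
    proof -
      have "N mod q < q" using assms by simp
      then consider "N mod q = c" | "N mod q < c" | "c < N mod q" "N mod q < q" by linarith
      then show ?thesis
      proof cases
        case 3
        then have "N mod q + (q - c) = (N mod q - c) + q" using assms by simp
        then have "(N mod q + (q - c)) mod q = (N mod q - c) mod q" by (simp only: mod_add_self2)
        then show ?thesis using 3 by simp
      qed (use assms in auto)
    qed
    ultimately show ?thesis by simp
  qed
  ultimately show ?case using Suc unfolding eq by (auto simp: div_Suc)
qed

lemma card_residue_class_interval:
  fixes c q x y :: nat assumes "q > 0"
  shows "\<bar>real (card {n \<in> {x<..x+y}. [n = c] (mod q)}) - real y / real q\<bar> \<le> 1"
proof -
  define d where "d = c mod q"
  have d: "d < q" using assms by (simp add: d_def)
  define A where "A = (\<lambda>N. {n \<in> {..<N}. n mod q = d})"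
  have "{n \<in> {x<..x+y}. [n = c] (mod q)} = A (Suc (x + y)) - A (Suc x)"
    by (auto simp: A_def cong_def d_def)
  also have "card \<dots> = card (A (Suc (x + y))) - card (A (Suc x))"
    by (rule card_Diff_subset) (auto simp: A_def)
  finally have "card {n \<in> {x<..x+y}. [n = c] (mod q)} = (Suc (x + y) + q - 1 - d) div q - (Suc x + q - 1 - d) div q"
    by (simp only: A_def card_residue_class_lessThan[OF d])
  moreover have "(Suc x + q - 1 - d) div q \<le> (Suc (x + y) + q - 1 - d) div q" by (rule div_le_mono) simp
  moreover define s where "s = Suc x + q - 1 - d"
  moreover have "Suc (x + y) + q - 1 - d = s + y" using d by (simp add: s_def)
  ultimately have 1: "real (card {n \<in> {x<..x+y}. [n = c] (mod q)}) = real ((s + y) div q) - real (s div q)" by simp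
  have b: "real k / real q - 1 < real (k div q)" "real (k div q) \<le> real k / real q" for k
  proof -
    have "real k = real q * real (k div q) + real (k mod q)" by (metis mult_div_mod_eq of_nat_add of_nat_mult)
    moreover have "real (k mod q) < real q" using assms by simp
    ultimately show "real k / real q - 1 < real (k div q)" "real (k div q) \<le> real k / real q" 
      using assms by (auto simp: field_simps)
  qed
  have "real (s + y) / real q = real s / real q + real y / real q" by (simp add: add_divide_distrib)
  then show ?thesis using b[of s] b[of "s + y"] unfolding 1 by linarith
qed

text \<open>The extra class modulo \<open>q\<close> carries the induction: by the Chinese remainder
  theorem, fixing a residue modulo a new prime \<open>r\<close> merges with it into one class modulo
  \<open>q * r\<close>. Each choice of residues costs an error of at most 1, and the right-hand side
  counts the choices.\<close>

lemma card_residue_sets_interval: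
  fixes \<Omega> :: "nat \<Rightarrow> nat set" and x y :: nat
  assumes "finite D" "\<And>r. r \<in> D \<Longrightarrow> prime r" "\<And>r. r \<in> D \<Longrightarrow> \<Omega> r \<subseteq> {..<r}"
    and "q > 0" "\<And>r. r \<in> D \<Longrightarrow> coprime q r"
  shows "\<bar>real (card {n \<in> {x<..x+y}. [n = c] (mod q) \<and> (\<forall>r\<in>D. n mod r \<in> \<Omega> r)})
    - real y * (\<Prod>r\<in>D. real (card (\<Omega> r)) / real r) / real q\<bar> \<le> (\<Prod>r\<in>D. real (card (\<Omega> r)))"
  using assms
proof (induction D arbitrary: q c rule: finite_induct)
  case empty
  then show ?case using card_residue_class_interval[of q x y c] by simp
next
  case (insert r D)
  define T where "T = (\<lambda>b. {n \<in> {x<..x+y}. ([n = c] (mod q) \<and> n mod r = b) \<and> (\<forall>r\<in>D. n mod r \<in> \<Omega> r)})"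
  have r: "prime r" "r > 0" using insert.prems(1)[of r] prime_gt_0_nat by auto
  have fin\<Omega>: "finite (\<Omega> r)" using insert.prems(2)[of r] finite_subset by auto
  define g where "g = real y * (\<Prod>r\<in>D. real (card (\<Omega> r)) / real r) / (real q * real r)"
  have T: "\<bar>real (card (T b)) - g\<bar> \<le> (\<Prod>r\<in>D. real (card (\<Omega> r)))" if b: "b \<in> \<Omega> r" for b
  proof -
    have br: "b < r" using insert.prems(2)[of r] b by auto
    have co: "coprime q r" using insert.prems by simp
    obtain z where z: "[z = c] (mod q)" "[z = b] (mod r)" using binary_chinese_remainder_nat[OF co] by blast
    have "[n = c] (mod q) \<and> n mod r = b \<longleftrightarrow> [n = z] (mod (q * r))" for n
    proof -
      have "n mod r = b \<longleftrightarrow> [n = b] (mod r)" using br by (simp add: cong_def)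
      moreover have "[n = c] (mod q) \<longleftrightarrow> [n = z] (mod q)" using z(1) by (auto simp: cong_def)
      moreover have "[n = b] (mod r) \<longleftrightarrow> [n = z] (mod r)" using z(2) by (auto simp: cong_def)
      ultimately show ?thesis using coprime_cong_mult_nat[OF _ _ co] cong_modulus_mult_nat 
        by (metis mult.commute)
    qed
    then have "T b = {n \<in> {x<..x+y}. [n = z] (mod (q * r)) \<and> (\<forall>r\<in>D. n mod r \<in> \<Omega> r)}"
      unfolding T_def by simp
    moreover have "coprime (q * r) r'" if "r' \<in> D" for r'
    proof -
      have "prime r'" "r' \<noteq> r" using insert that by auto
      then have "coprime r r'" using r primes_coprime by blast
      then show ?thesis using insert.prems(4)[of r'] that by simp
    qed
    moreover have "\<And>r. r \<in> D \<Longrightarrow> prime r" "\<And>r. r \<in> D \<Longrightarrow> \<Omega> r \<subseteq> {..<r}" using insert.prems by auto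
    ultimately show ?thesis using insert.IH[of "q * r" z] insert.prems(3) r
      by (simp add: g_def)
  qed
  have "{n \<in> {x<..x+y}. [n = c] (mod q) \<and> (\<forall>r\<in>insert r D. n mod r \<in> \<Omega> r)} = (\<Union>b\<in>\<Omega> r. T b)"
    by (auto simp: T_def)
  also have "card \<dots> = (\<Sum>b\<in>\<Omega> r. card (T b))"
    by (rule card_UN_disjoint[OF fin\<Omega>]) (auto simp: T_def)
  finally have 1: "real (card {n \<in> {x<..x+y}. [n = c] (mod q) \<and> (\<forall>r\<in>insert r D. n mod r \<in> \<Omega> r)}) = (\<Sum>b\<in>\<Omega> r. real (card (T b)))"
    by simp
  have "real y * (\<Prod>r\<in>insert r D. real (card (\<Omega> r)) / real r) / real q = (\<Sum>b\<in>\<Omega> r. g)"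
    using insert.hyps r insert.prems(3) by (simp add: g_def field_simps)
  then have "\<bar>real (card {n \<in> {x<..x+y}. [n = c] (mod q) \<and> (\<forall>r\<in>insert r D. n mod r \<in> \<Omega> r)})
    - real y * (\<Prod>r\<in>insert r D. real (card (\<Omega> r)) / real r) / real q\<bar> = \<bar>\<Sum>b\<in>\<Omega> r. real (card (T b)) - g\<bar>"
    unfolding 1 by (simp only: sum_subtractf)
  also have "\<dots> \<le> (\<Sum>b\<in>\<Omega> r. \<bar>real (card (T b)) - g\<bar>)" by (rule sum_abs)
  also have "\<dots> \<le> (\<Sum>b\<in>\<Omega> r. \<Prod>r\<in>D. real (card (\<Omega> r)))" by (intro sum_mono T)
  also have "\<dots> = (\<Prod>r\<in>insert r D. real (card (\<Omega> r)))" using insert.hyps by simp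
  finally show ?case .
qed

section \<open>Truncated inclusion-exclusion\<close>

lemma truncated_alternating_binomial_sum:
  "(\<Sum>k\<le>m. (- 1) ^ k * real (Suc f choose k)) = (- 1) ^ m * real (f choose m)"
  by (induction m) (auto simp: algebra_simps)

text \<open>Grouped by cardinality, the sum for nonempty \<open>F\<close> collapses to
  \<open>(- 1) ^ m\<close> times a binomial coefficient, which is nonnegative for even
  \<open>m\<close>.\<close>

lemma bonferroni_even:
  assumes "finite F" "even m"
  shows "(if F = {} then 1 else 0) \<le> (\<Sum>D | D \<subseteq> F \<and> card D \<le> m. (- 1) ^ card D :: real)"
proof -
  have "(\<Sum>D | D \<subseteq> F \<and> card D \<le> m. (- 1) ^ card D :: real) = (\<Sum>k\<le>m. \<Sum>D | D \<in> {D. D \<subseteq> F \<and> card D \<le> m} \<and> card D = k. (- 1) ^ card D)"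
    by (rule sum.group[symmetric]) (use assms in auto)
  also have "\<dots> = (\<Sum>k\<le>m. (- 1) ^ k * real (card F choose k))"
  proof (intro sum.cong refl)
    fix k assume "k \<in> {..m}"
    then have "{D. D \<in> {D. D \<subseteq> F \<and> card D \<le> m} \<and> card D = k} = {D. D \<subseteq> F \<and> card D = k}" by auto
    then show "(\<Sum>D | D \<in> {D. D \<subseteq> F \<and> card D \<le> m} \<and> card D = k. (- 1) ^ card D) = (- 1) ^ k * real (card F choose k)"
      using n_subsets[OF assms(1), of k] by simp
  qed
  also have "\<dots> \<ge> (if F = {} then 1 else 0)"
  proof (cases "card F")
    case 0
    then have "F = {}" using assms by simp
    moreover have "(\<Sum>k\<le>m. (- 1) ^ k * real (0 choose k)) = (\<Sum>k\<in>{0}. (- 1) ^ k * real (0 choose k))"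
      by (rule sum.mono_neutral_right) auto
    ultimately show ?thesis by simp
  next
    case (Suc f)
    then have "F \<noteq> {}" by auto
    then show ?thesis unfolding Suc truncated_alternating_binomial_sum using assms by simp
  qed
  finally show ?thesis .
qed

lemma sum_Pow_prod:
  fixes f :: "'a \<Rightarrow> real" assumes "finite P"
  shows "(\<Sum>D\<in>Pow P. \<Prod>r\<in>D. f r) = (\<Prod>r\<in>P. 1 + f r)"
proof -
  have "(\<Prod>r\<in>P. f r + 1) = (\<Sum>D\<in>Pow P. (\<Prod>r\<in>D. f r) * (\<Prod>r\<in>P - D. 1))"
    by (rule prod_add) fact
  then show ?thesis by (simp add: add.commute)
qed

lemma prod_one_plus_le_exp:
  fixes f :: "'a \<Rightarrow> real" assumes "\<And>r. r \<in> P \<Longrightarrow> - 1 \<le> f r"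
  shows "(\<Prod>r\<in>P. 1 + f r) \<le> exp (\<Sum>r\<in>P. f r)"
proof (cases "finite P")
  case True
  have "(\<Prod>r\<in>P. 1 + f r) \<le> (\<Prod>r\<in>P. exp (f r))"
    by (rule prod_mono) (use assms in \<open>force simp: exp_ge_add_one_self\<close>)
  then show ?thesis using True by (simp add: exp_sum)
qed auto

text \<open>Both error terms are estimated by Rankin's trick: a set of more than \<open>m\<close>
  primes is weighted by \<open>4 ^ (card D - m)\<close>, a set of at most \<open>m\<close> primes by \<open>Y ^ (m - card D)\<close>.\<close>
lemma brun_sieve:
  fixes \<Omega> :: "nat \<Rightarrow> nat set" and x y m :: nat and Y :: real
  assumes P: "finite P" "\<And>r. r \<in> P \<Longrightarrow> prime r" "\<And>r. r \<in> P \<Longrightarrow> \<Omega> r \<subseteq> {..<r}"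
    and m: "even m"
    and Y: "1 \<le> Y" "(\<Sum>r\<in>P. real (card (\<Omega> r))) \<le> Y"
  defines "L \<equiv> \<Sum>r\<in>P. real (card (\<Omega> r)) / real r"
  shows "real (card {n \<in> {x<..x+y}. \<forall>r\<in>P. n mod r \<notin> \<Omega> r})
    \<le> real y * (exp (- L) + exp (4 * L) / 4 ^ m) + exp 1 * Y ^ m"
proof -
  define g where "g = (\<lambda>r. real (card (\<Omega> r)) / real r)"
  define I where "I = {x<..x+y}"
  define N where "N = (\<lambda>D. {n \<in> I. \<forall>r\<in>D. n mod r \<in> \<Omega> r})"
  define F where "F = (\<lambda>n. {r \<in> P. n mod r \<in> \<Omega> r})"
  define Pm where "Pm = {D. D \<subseteq> P \<and> card D \<le> m}"
  define Q where "Q = {D. D \<subseteq> P \<and> \<not> card D \<le> m}"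
  have finD: "finite D" if "D \<subseteq> P" for D using finite_subset[OF that P(1)] .
  have PmQ: "finite Pm" "finite Q" "Pm \<inter> Q = {}" "Pm \<union> Q = Pow P" 
    using P(1) by (auto simp: Pm_def Q_def)
  have g01: "0 \<le> g r" "g r \<le> 1" if "r \<in> P" for r
  proof -
    show "0 \<le> g r" by (simp add: g_def)
    have "card (\<Omega> r) \<le> r" using card_mono[OF _ P(3)[OF that]] by simp
    then show "g r \<le> 1" using P(2)[OF that] prime_gt_0_nat by (simp add: g_def divide_le_eq)
  qed
  have "real (card {n \<in> I. \<forall>r\<in>P. n mod r \<notin> \<Omega> r}) = (\<Sum>n\<in>I. if F n = {} then 1 else 0)"
  proof -
    have "{n \<in> I. \<forall>r\<in>P. n mod r \<notin> \<Omega> r} = {n \<in> I. F n = {}}" by (auto simp: F_def)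
    then show ?thesis by (simp add: I_def sum.If_cases Int_def)
  qed
  \<comment> \<open>\<open>n\<close> survives exactly if \<open>F n\<close> is empty; Bonferroni's
    inequality replaces this indicator.\<close>
  also have "\<dots> \<le> (\<Sum>n\<in>I. \<Sum>D | D \<subseteq> F n \<and> card D \<le> m. (- 1) ^ card D)"
    by (intro sum_mono bonferroni_even m) (auto simp: F_def P)
  also have "\<dots> = (\<Sum>n\<in>I. \<Sum>D\<in>Pm. if n \<in> N D then (- 1) ^ card D else 0)"
  proof (rule sum.cong[OF refl])
    fix n assume "n \<in> I"
    then have "{D. D \<subseteq> F n \<and> card D \<le> m} = {D \<in> Pm. n \<in> N D}"
      by (auto simp: Pm_def N_def F_def)
    then show "(\<Sum>D | D \<subseteq> F n \<and> card D \<le> m. (- 1 :: real) ^ card D) = (\<Sum>D\<in>Pm. if n \<in> N D then (- 1) ^ card D else 0)"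
      using PmQ by (simp add: sum.inter_filter)
  qed
  also have "\<dots> = (\<Sum>D\<in>Pm. \<Sum>n\<in>I. if n \<in> N D then (- 1) ^ card D else 0)"
    by (rule sum.swap)
  also have "\<dots> = (\<Sum>D\<in>Pm. (- 1) ^ card D * real (card (N D)))"
  proof (rule sum.cong[OF refl])
    fix D
    have "{n \<in> I. n \<in> N D} = N D" by (auto simp: N_def)
    then show "(\<Sum>n\<in>I. if n \<in> N D then (- 1 :: real) ^ card D else 0) = (- 1) ^ card D * real (card (N D))"
      using sum.inter_filter[of I "\<lambda>_. (- 1) ^ card D :: real" "\<lambda>n. n \<in> N D"] by (simp add: I_def mult.commute)
  qed
  also have "\<dots> \<le> (\<Sum>D\<in>Pm. real y * (\<Prod>r\<in>D. - g r) + (\<Prod>r\<in>D. real (card (\<Omega> r))))"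
  proof (rule sum_mono)
    fix D assume "D \<in> Pm"
    then have D: "D \<subseteq> P" by (simp add: Pm_def)
    \<comment> \<open>The congruence modulo 1 is vacuous and serves only to start the general
      count.\<close>
    have "\<bar>real (card {n \<in> {x<..x+y}. [n = 0] (mod 1) \<and> (\<forall>r\<in>D. n mod r \<in> \<Omega> r)})
      - real y * (\<Prod>r\<in>D. real (card (\<Omega> r)) / real r) / real 1\<bar> \<le> (\<Prod>r\<in>D. real (card (\<Omega> r)))"
    proof (rule card_residue_sets_interval)
      show "\<Omega> r \<subseteq> {..<r}" if "r \<in> D" for r using P(3) D that by blast
    qed (use finD D P in auto)
    then have *: "\<bar>real (card (N D)) - real y * (\<Prod>r\<in>D. g r)\<bar> \<le> (\<Prod>r\<in>D. real (card (\<Omega> r)))"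
      by (simp add: N_def I_def g_def)
    have "(\<Prod>r\<in>D. - g r) = (- 1) ^ card D * (\<Prod>r\<in>D. g r)" 
      by (subst minus_one_power_iff) (simp add: prod_uminus minus_one_power_iff)
    then show "(- 1) ^ card D * real (card (N D)) \<le> real y * (\<Prod>r\<in>D. - g r) + (\<Prod>r\<in>D. real (card (\<Omega> r)))"
      using * by (cases "even (card D)") auto
  qed
  also have "\<dots> = real y * (\<Sum>D\<in>Pm. \<Prod>r\<in>D. - g r) + (\<Sum>D\<in>Pm. \<Prod>r\<in>D. real (card (\<Omega> r)))"
    by (simp add: sum.distrib sum_distrib_left)
  also have "(\<Sum>D\<in>Pm. \<Prod>r\<in>D. - g r) \<le> exp (- L) + exp (4 * L) / 4 ^ m"
  proof -
    \<comment> \<open>The sum over all subsets is the product of \<open>1 - g r\<close>, at most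
      \<open>exp (- L)\<close>; the sets with more than \<open>m\<close> elements are then
      subtracted.\<close>
    have "(\<Sum>D\<in>Pow P. \<Prod>r\<in>D. - g r) = (\<Sum>D\<in>Pm. \<Prod>r\<in>D. - g r) + (\<Sum>D\<in>Q. \<Prod>r\<in>D. - g r)"
      using PmQ by (subst sum.union_disjoint[symmetric]) auto
    moreover have "(\<Sum>D\<in>Pow P. \<Prod>r\<in>D. - g r) \<le> exp (- L)"
      using prod_one_plus_le_exp[of P "\<lambda>r. - g r"] g01 sum_Pow_prod[OF P(1), of "\<lambda>r. - g r"]
      by (simp add: L_def g_def sum_negf)
    moreover have "- (\<Sum>D\<in>Q. \<Prod>r\<in>D. - g r) \<le> exp (4 * L) / 4 ^ m"
    proof -
      have "- (\<Sum>D\<in>Q. \<Prod>r\<in>D. - g r) = (\<Sum>D\<in>Q. - (\<Prod>r\<in>D. - g r))" by (simp add: sum_negf)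
      also have "\<dots> \<le> (\<Sum>D\<in>Q. (\<Prod>r\<in>D. 4 * g r) / 4 ^ m)"
      proof (rule sum_mono)
        fix D assume "D \<in> Q"
        then have D: "D \<subseteq> P" "m \<le> card D" by (auto simp: Q_def)
        have pos: "0 \<le> (\<Prod>r\<in>D. g r)" using D g01 by (intro prod_nonneg) auto
        have "(\<Prod>r\<in>D. g r) * 4 ^ m \<le> (\<Prod>r\<in>D. g r) * 4 ^ card D"
          using D pos by (intro mult_left_mono power_increasing) auto
        then have le: "(\<Prod>r\<in>D. g r) \<le> (\<Prod>r\<in>D. g r) * 4 ^ card D / 4 ^ m"
          by (simp add: pos_le_divide_eq)
        have "- (\<Prod>r\<in>D. - g r) \<le> \<bar>\<Prod>r\<in>D. - g r\<bar>" by simp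
        also have "\<dots> = (\<Prod>r\<in>D. g r)" using pos by (simp add: abs_prod) (simp add: g_def)
        also note le
        also have "(\<Prod>r\<in>D. g r) * 4 ^ card D / 4 ^ m = (\<Prod>r\<in>D. 4 * g r) / 4 ^ m"
          by (simp add: prod.distrib mult.commute)
        finally show "- (\<Prod>r\<in>D. - g r) \<le> (\<Prod>r\<in>D. 4 * g r) / 4 ^ m" .
      qed
      also have "\<dots> \<le> (\<Sum>D\<in>Pow P. (\<Prod>r\<in>D. 4 * g r) / 4 ^ m)"
        using P(1) g01 by (intro sum_mono2) (auto simp: Q_def intro!: divide_nonneg_nonneg prod_nonneg)
      also have "\<dots> = (\<Prod>r\<in>P. 1 + 4 * g r) / 4 ^ m"
        by (simp add: sum_Pow_prod[OF P(1)] flip: sum_divide_distrib)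
      also have "\<dots> \<le> exp (\<Sum>r\<in>P. 4 * g r) / 4 ^ m"
        using g01 by (intro divide_right_mono prod_one_plus_le_exp) (auto intro: order_trans[of _ 0])
      also have "(\<Sum>r\<in>P. 4 * g r) = 4 * L" by (simp add: L_def g_def sum_distrib_left)
      finally show ?thesis .
    qed
    ultimately show ?thesis by linarith
  qed
  also have "(\<Sum>D\<in>Pm. \<Prod>r\<in>D. real (card (\<Omega> r))) \<le> exp 1 * Y ^ m"
  proof -
    have "(\<Sum>D\<in>Pm. \<Prod>r\<in>D. real (card (\<Omega> r))) \<le> (\<Sum>D\<in>Pm. Y ^ m * (\<Prod>r\<in>D. real (card (\<Omega> r)) / Y))"
    proof (rule sum_mono)
      fix D assume "D \<in> Pm"
      then have D: "card D \<le> m" by (simp add: Pm_def)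
      have "(\<Prod>r\<in>D. real (card (\<Omega> r))) = Y ^ card D * (\<Prod>r\<in>D. real (card (\<Omega> r)) / Y)"
        using Y(1) by (simp add: prod_dividef)
      also have "\<dots> \<le> Y ^ m * (\<Prod>r\<in>D. real (card (\<Omega> r)) / Y)"
        using D Y(1) by (intro mult_right_mono power_increasing prod_nonneg) auto
      finally show "(\<Prod>r\<in>D. real (card (\<Omega> r))) \<le> Y ^ m * (\<Prod>r\<in>D. real (card (\<Omega> r)) / Y)" .
    qed
    also have "\<dots> \<le> (\<Sum>D\<in>Pow P. Y ^ m * (\<Prod>r\<in>D. real (card (\<Omega> r)) / Y))"
      using P(1) Y(1) by (intro sum_mono2) (auto simp: Pm_def intro!: mult_nonneg_nonneg prod_nonneg)
    also have "\<dots> = Y ^ m * (\<Prod>r\<in>P. 1 + real (card (\<Omega> r)) / Y)"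
      by (simp add: sum_Pow_prod[OF P(1)] flip: sum_distrib_left)
    also have "\<dots> \<le> Y ^ m * exp (\<Sum>r\<in>P. real (card (\<Omega> r)) / Y)"
      using Y(1) by (intro mult_left_mono prod_one_plus_le_exp) (auto intro: order_trans[of _ 0])
    also have "\<dots> \<le> Y ^ m * exp 1"
      using Y by (intro mult_left_mono) (auto simp flip: sum_divide_distrib)
    finally show ?thesis by (simp add: mult.commute)
  qed
  finally show ?thesis by (simp add: I_def mult_left_mono)
qed

section \<open>Divisor sums and cyclotomic roots\<close>

text \<open>For a primitive root \<open>g\<close> and \<open>c = (r - 1) / l\<close>, the powers
  \<open>g ^ (i * c)\<close> with \<open>0 < i < l\<close> are distinct roots of
  \<open>x ^ l - 1\<close> other than 1, hence roots of its cofactor after division by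
  \<open>x - 1\<close>.\<close>

lemma exists_cyclotomic_roots:
  fixes l r :: nat
  assumes r: "prime r" and l: "l > 1" "r mod l = 1"
  shows "\<exists>A. A \<subseteq> {1..<r} \<and> card A = l - 1 \<and> (\<forall>c\<in>A. r dvd (\<Sum>i<l. c ^ i))"
proof -
  obtain g where g: "coprime r g" "ord r g = r - 1"
    using prime_primitive_root_exists[of r] r prime_gt_1_nat[OF r]
    by (auto simp: residue_primroot_def totient_prime)
  have r1: "r > 1" using r prime_gt_1_nat by blast
  have "l dvd r - 1" using l by (metis mod_eq_dvd_iff_nat less_imp_le mod_less r1)
  then obtain c where c: "r - 1 = l * c" ..
  have c0: "c > 0" using c r1 by (auto intro!: Nat.gr0I)
  define f where "f = (\<lambda>i. g ^ (i * c) mod r)"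
  have ne: "i = j" if "i < l" "j < l" "f i = f j" for i j
  proof -
    have "[i * c = j * c] (mod (r - 1))"
      using that order_divides_expdiff[OF g(1), of "i * c" "j * c"] g by (simp add: f_def cong_def)
    moreover have "i * c < r - 1" "j * c < r - 1" using that c c0 by auto
    ultimately show ?thesis using c0 by (simp add: cong_def)
  qed
  have f0: "f 0 = 1" using r1 by (simp add: f_def)
  have "r dvd (\<Sum>k<l. f i ^ k)" if i: "i \<in> {1..<l}" for i
  proof -
    define x where "x = int (f i)"
    have "[g ^ (i * c * l) = 1] (mod r)"
      using ord_divides[of g "i * c * l" r] g c by (simp add: mult_ac)
    then have "[f i ^ l = 1] (mod r)"
      by (simp add: f_def cong_def power_mod power_mult)
    then have "[x ^ l = 1] (mod int r)" 
      unfolding x_def by (metis cong_int_iff of_nat_1 of_nat_power)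
    then have "int r dvd (x - 1) * (\<Sum>k<l. x ^ k)"
      by (simp add: power_diff_1_eq[symmetric] cong_iff_dvd_diff)
    moreover have "\<not> int r dvd x - 1"
    proof
      assume "int r dvd x - 1"
      then have "[x = int 1] (mod int r)" by (simp add: cong_iff_dvd_diff)
      then have "[f i = 1] (mod r)" unfolding x_def cong_int_iff .
      then have "f i = f 0" using f0 r1 by (simp add: f_def cong_def)
      then show False using ne[of i 0] i by auto
    qed
    ultimately have "int r dvd (\<Sum>k<l. x ^ k)" using r by (auto simp: prime_dvd_mult_iff)
    then have "int r dvd int (\<Sum>k<l. f i ^ k)" by (simp add: x_def)
    then show ?thesis by (simp only: of_nat_dvd_iff)
  qed
  moreover have "f ` {1..<l} \<subseteq> {1..<r}"
  proof -
    have "coprime r (g ^ (i * c))" for i using g by simp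
    then have "\<not> r dvd g ^ (i * c)" for i using r1 by (metis coprime_absorb_left nat_dvd_1_iff_1 less_irrefl)
    then show ?thesis using r1 by (auto simp: f_def Suc_le_eq dvd_eq_mod_eq_0)
  qed
  moreover have "card (f ` {1..<l}) = l - 1"
    by (subst card_image) (auto simp: inj_on_def intro!: ne)
  ultimately show ?thesis by (intro exI[of _ "f ` {1..<l}"]) auto
qed

section \<open>Multiplicativity of the divisor sum and the reciprocals of the prime factors of a
  perfect number\<close>

lemma divisor_sigma_mult_coprime:
  assumes "coprime a b" "a > 0" "b > 0"
  shows "divisor_sigma (a * b) = divisor_sigma a * divisor_sigma b"
proof -
  have "inj_on (\<lambda>(x, y). x * y) ({d. d dvd a} \<times> {d. d dvd b})"
  proof (rule inj_onI, clarify)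
    fix x y x' y' assume d: "x dvd a" "y dvd b" "x' dvd a" "y' dvd b" and eq: "x * y = x' * y'"
    have "coprime x y'" "coprime x' y" using d assms(1) by (meson coprime_divisors)+
    then have "x dvd x'" "x' dvd x" using eq 
      by (metis coprime_dvd_mult_left_iff dvd_triv_left)+
    then have "x = x'" by (rule dvd_antisym)
    moreover have "x > 0" using d assms dvd_pos_nat by blast
    ultimately show "x = x' \<and> y = y'" using eq by simp
  qed
  moreover have "{d. d dvd a * b} = (\<lambda>(x, y). x * y) ` ({d. d dvd a} \<times> {d. d dvd b})"
    using division_decomp[of _ a b] by (auto intro: mult_dvd_mono)
  ultimately have "divisor_sigma (a * b) = (\<Sum>(x, y)\<in>{d. d dvd a} \<times> {d. d dvd b}. x * y)"
    by (simp add: divisor_sigma_def sum.reindex case_prod_unfold)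
  then show ?thesis by (simp add: divisor_sigma_def sum_product sum.cartesian_product)
qed

lemma divisor_sigma_prime_power:
  assumes "prime p" shows "divisor_sigma (p ^ k) = (\<Sum>i\<le>k. p ^ i)"
proof -
  have "{d. d dvd p ^ k} = (\<lambda>i. p ^ i) ` {..k}"
    using assms by (auto simp: divides_primepow_nat)
  moreover have "inj_on (\<lambda>i. p ^ i) {..k}"
    using prime_gt_1_nat[OF assms] by (auto simp: inj_on_def power_inject_exp)
  ultimately show ?thesis by (simp add: divisor_sigma_def sum.reindex)
qed

lemma divisor_sigma_prod_prime_powers:
  assumes "finite S" "\<And>r. r \<in> S \<Longrightarrow> prime r"
  shows "divisor_sigma (\<Prod>r\<in>S. r ^ v r) = (\<Prod>r\<in>S. divisor_sigma (r ^ v r))"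
  using assms
proof (induction S rule: finite_induct)
  case empty
  show ?case by (simp add: divisor_sigma_def)
next
  case (insert p S)
  have "coprime (p ^ v p) (\<Prod>r\<in>S. r ^ v r)"
    using insert by (intro prod_coprime_right) (auto intro!: primes_coprime)
  moreover have "(\<Prod>r\<in>S. r ^ v r) > 0" using insert by (intro prod_pos) (auto simp: prime_gt_0_nat)
  moreover have "p ^ v p > 0" using insert by (simp add: prime_gt_0_nat)
  ultimately show ?case using insert by (simp add: divisor_sigma_mult_coprime)
qed

lemma divisor_sigma_eq_prod:
  assumes "N > 0"
  shows "divisor_sigma N = (\<Prod>r\<in>prime_factors N. divisor_sigma (r ^ multiplicity r N))"
  using divisor_sigma_prod_prime_powers[of "prime_factors N" "\<lambda>r. multiplicity r N"] assms
  by (simp add: prod_prime_factors in_prime_factors_imp_prime)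

text \<open>The lower bound keeps the two largest terms of the geometric sum; the upper bound drops
  the \<open>- 1\<close> in its closed form.\<close>

lemma
  assumes p: "prime p" and k: "k > 0"
  shows divisor_sigma_prime_power_ge: "real (p ^ k) * (1 + 1 / real p) \<le> real (divisor_sigma (p ^ k))"
    and divisor_sigma_prime_power_le: "real (divisor_sigma (p ^ k)) \<le> real (p ^ k) * (1 + 1 / (real p - 1))"
proof -
  have p1: "real p > 1" using prime_gt_1_nat[OF p] by simp
  obtain j where j: "k = Suc j" using k gr0_implies_Suc by blast
  have eq: "real (divisor_sigma (p ^ k)) = (\<Sum>i\<le>k. real p ^ i)" by (simp add: divisor_sigma_prime_power p)
  have "(\<Sum>i\<in>{j, Suc j}. real p ^ i) \<le> (\<Sum>i\<le>k. real p ^ i)"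
    by (rule sum_mono2) (use p1 in \<open>auto simp: j\<close>)
  then show "real (p ^ k) * (1 + 1 / real p) \<le> real (divisor_sigma (p ^ k))"
    unfolding eq using p1 by (simp add: j field_simps)
  have "(real p - 1) * (\<Sum>i\<le>k. real p ^ i) = real p ^ Suc k - 1"
    using power_diff_1_eq[of "real p" "Suc k"] by (simp add: lessThan_Suc_atMost)
  then show "real (divisor_sigma (p ^ k)) \<le> real (p ^ k) * (1 + 1 / (real p - 1))"
    unfolding eq using p1 by (simp add: field_simps)
qed

text \<open>The ratio \<open>divisor_sigma N / N = 2\<close> lies between the products of
  \<open>1 + 1 / r\<close> and of \<open>1 + 1 / (r - 1)\<close>. For \<open>r \<ge> 1001\<close>
  the logarithms of these factors are \<open>1 / r\<close> up to a factor \<open>1001/1000\<close>,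
  so the sum is close to \<open>ln 2\<close>.\<close>

lemma
  assumes "perfect_number N" and big: "\<And>r. prime r \<Longrightarrow> r dvd N \<Longrightarrow> r \<ge> 1001"
  shows perfect_sum_inverse_primes_le: "(\<Sum>r\<in>prime_factors N. 1 / real r) \<le> 7/10"
    and perfect_sum_inverse_primes_ge: "(\<Sum>r\<in>prime_factors N. 1 / real r) \<ge> 6/10"
proof -
  define s where "s = (\<Sum>r\<in>prime_factors N. 1 / real r)"
  have N: "N > 0" "divisor_sigma N = 2 * N" using assms by (auto simp: perfect_number_def)
  have r: "prime r" "r dvd N" "real r \<ge> 1001" "multiplicity r N > 0" if "r \<in> prime_factors N" for r
  proof -
    show "prime r" "r dvd N" using that by auto
    then show "real r \<ge> 1001" using big[of r] by simp
    show "multiplicity r N > 0" using that by (simp add: prime_factors_multiplicity)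
  qed
  have "real N = (\<Prod>r\<in>prime_factors N. real (r ^ multiplicity r N))"
    using prod_prime_factors[of N] N by (metis normalize_nat_def of_nat_prod id_apply less_irrefl)
  then have prod2: "real N * (\<Prod>r\<in>prime_factors N. f r) = (\<Prod>r\<in>prime_factors N. real (r ^ multiplicity r N) * f r)" for f
    by (simp add: prod.distrib)
  have sig: "2 * real N = (\<Prod>r\<in>prime_factors N. real (divisor_sigma (r ^ multiplicity r N)))"
    using divisor_sigma_eq_prod[OF N(1)] N(2) by (metis of_nat_prod of_nat_mult of_nat_numeral)
  have "exp (1000/1001 * s) = (\<Prod>r\<in>prime_factors N. exp (1000/1001 * (1 / real r)))"
    by (simp add: s_def sum_distrib_left exp_sum)
  also have "\<dots> \<le> (\<Prod>r\<in>prime_factors N. 1 + 1 / real r)"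
  proof (rule prod_mono, safe)
    fix p assume p: "p \<in> prime_factors N"
    have "1000/1001 * (1 / real p) \<le> 1 / (real p + 1)" using r[OF p] by (simp add: field_simps)
    also have "exp (1 / (real p + 1)) \<le> 1 + 1 / real p"
    proof -
      \<comment> \<open>Inverting \<open>1 - x \<le> exp (- x)\<close> at
        \<open>x = 1 / (p + 1)\<close> gives \<open>exp x \<le> 1 + 1 / p\<close>.\<close>
      have "1 + (- (1 / (real p + 1))) \<le> exp (- (1 / (real p + 1)))" by (rule exp_ge_add_one_self)
      then have "exp (1 / (real p + 1)) * (1 - 1 / (real p + 1)) \<le> exp (1 / (real p + 1)) * exp (- (1 / (real p + 1)))"
        by (intro mult_left_mono) auto
      also have "\<dots> = 1" by (simp flip: exp_add)
      finally have "exp (1 / (real p + 1)) * (real p / (real p + 1)) \<le> 1" by (simp add: field_simps)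
      then show ?thesis using r[OF p] by (simp add: field_simps)
    qed
    finally show "exp (1000/1001 * (1 / real p)) \<le> 1 + 1 / real p" by simp
  qed auto
  also have "\<dots> \<le> 2"
  proof -
    have "real N * (\<Prod>r\<in>prime_factors N. 1 + 1 / real r) \<le> 2 * real N"
      unfolding prod2 sig by (intro prod_mono conjI divisor_sigma_prime_power_ge r) auto
    then show ?thesis using N by simp
  qed
  finally have "1000/1001 * s \<le> ln 2" by (subst ln_ge_iff) auto
  then show "s \<le> 7/10" using ln2_le_25_over_36 by simp
  have "2 * real N \<le> real N * (\<Prod>r\<in>prime_factors N. 1 + 1 / (real r - 1))"
    unfolding prod2 sig by (intro prod_mono conjI divisor_sigma_prime_power_le r) auto
  then have "2 \<le> (\<Prod>r\<in>prime_factors N. 1 + 1 / (real r - 1))" using N by simp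
  also have "\<dots> \<le> exp (\<Sum>r\<in>prime_factors N. 1 / (real r - 1))"
  proof (rule prod_one_plus_le_exp)
    fix p assume "p \<in> prime_factors N"
    then have "0 \<le> 1 / (real p - 1)" using r(3)[of p] by simp
    then show "- 1 \<le> 1 / (real p - 1)" by linarith
  qed
  also have "\<dots> \<le> exp (1001/1000 * s)"
    unfolding s_def sum_distrib_left
  proof (subst exp_le_cancel_iff, rule sum_mono)
    fix p assume "p \<in> prime_factors N"
    then show "1 / (real p - 1) \<le> 1001/1000 * (1 / real p)" using r(3)[of p] by (simp add: field_simps)
  qed
  finally have "ln 2 \<le> ln (exp (1001/1000 * s))" by (subst ln_le_cancel_iff) auto
  then have "ln 2 \<le> 1001/1000 * s" by simp
  then show "s \<ge> 6/10" using ln2_ge_two_thirds by simp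
qed

section \<open>Sifting the prime factors\<close>

text \<open>Adding elements one by one overshoots \<open>T\<close> by at most 1. The sieve needs the
  upper bound too, since its truncation error grows like \<open>exp (4 * L)\<close>.\<close>

lemma exists_subset_sum_between:
  fixes f :: "'a \<Rightarrow> real"
  assumes "finite A" "\<And>a. a \<in> A \<Longrightarrow> 0 \<le> f a" "\<And>a. a \<in> A \<Longrightarrow> f a \<le> 1" "0 \<le> T" "T \<le> sum f A"
  shows "\<exists>P\<subseteq>A. T \<le> sum f P \<and> sum f P \<le> T + 1"
  using assms
proof (induction A rule: finite_induct)
  case (insert a A)
  show ?case
  proof (cases "T \<le> sum f A")
    case True
    then show ?thesis using insert by (meson insertCI subset_insertI2)
  next
    case False
    moreover have "f a \<le> 1" using insert.prems by simp
    ultimately have "sum f (insert a A) \<le> T + 1" using insert.hyps by simp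
    then show ?thesis using insert.prems by blast
  qed
qed auto

text \<open>The exponent is \<open>33/5 + 7/2\<close>: the loss in the sum over primes plus the loss
  from leaving out the primes in \<open>W\<close>.\<close>

lemma exp_ten_point_one_le: "exp (101/10 :: real) \<le> 25000"
proof -
  have "exp (101/10 :: real) = exp 1 ^ 10 * exp (1/10)"
    by (simp flip: exp_of_nat_mult exp_add)
  also have "\<dots> \<le> (272/100) ^ 10 * (10/9)"
  proof (intro mult_mono power_mono)
    have "1 + (- (1/10)) \<le> exp (- (1/10) :: real)" by (rule exp_ge_add_one_self)
    then have "exp (1/10) * (9/10) \<le> exp (1/10) * exp (- (1/10) :: real)" by (intro mult_left_mono) auto
    also have "\<dots> = 1" by (simp flip: exp_add)
    finally show "exp (1/10 :: real) \<le> 10/9" by simp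
  qed (use e_less_272 in auto)
  also have "\<dots> \<le> 25000" by (simp add: power_numeral_reduce)
  finally show ?thesis .
qed

text \<open>The parameters of the sieve on \<open>{2 ^ 2 ^ j..2 ^ 2 ^ (j + 1)}\<close> with \<open>j = 36 + i\<close>: primes up to
  \<open>2 ^ u\<close> are used, products of at most \<open>m\<close> primes are taken into account, and the proportion of
  unsifted numbers comes out as \<open>O(1 / K)\<close>.\<close>

lemma sieve_parameters:
  fixes i :: nat
  defines "m \<equiv> 4 * i + 108" and "H \<equiv> 2 ^ (i + 36) :: nat" and "K \<equiv> 3 * 10 ^ 12 * 3 ^ i :: real"
  defines "u \<equiv> H div m - 4"
  shows "exp (4 * (ln K + 1)) / 4 ^ m \<le> 1 / K"
    and "exp 1 * (5 * 2 ^ u) ^ m \<le> 2 ^ H / K"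
    and "u \<ge> 33"
    and "ln K \<le> 2 * ln (real u * ln 2) - 101/10"
proof -
  have "1 * 1 \<le> 3 * 10 ^ 12 * (3 :: real) ^ i" by (intro mult_mono) auto
  then have K: "K \<ge> 1" by (simp only: K_def)
  have e3: "exp 1 \<le> (272/100 :: real)" using e_less_272 by simp
  \<comment> \<open>This fixes \<open>m\<close>: 55 bounds \<open>exp 4\<close>, the slope 4 comes
    from \<open>3 ^ 5 \<le> 4 ^ 4\<close>, and 108 is the least even exponent that works at
    \<open>i = 0\<close>.\<close>
  have "55 * K ^ 5 \<le> 4 ^ m"
  proof -
    have "((3 :: real) ^ i) ^ 5 = (3 ^ 5) ^ i" by (simp only: power_mult[symmetric] mult.commute)
    then have "55 * K ^ 5 = (55 * (3 * 10 ^ 12) ^ 5) * 243 ^ i"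
      by (simp add: K_def power_mult_distrib)
    also have "\<dots> \<le> 4 ^ 108 * 256 ^ i" by (intro mult_mono power_mono) auto
    also have "\<dots> = 4 ^ m" by (simp add: m_def power_add power_mult)
    finally show ?thesis .
  qed
  moreover have "exp (4 * (ln K + 1)) = K ^ 4 * exp 1 ^ 4"
  proof -
    have "exp (4 * (ln K + 1)) = exp (ln K + 1) ^ 4" by (simp flip: exp_of_nat_mult)
    also have "exp (ln K + 1) = K * exp 1" using K by (simp add: exp_add)
    finally show ?thesis by (simp add: power_mult_distrib)
  qed
  moreover have "exp 1 ^ 4 \<le> (55 :: real)"
  proof -
    have "exp 1 ^ 4 \<le> (272/100 :: real) ^ 4" using e3 by (intro power_mono) auto
    then show ?thesis by (simp add: power_numeral_reduce)
  qed
  ultimately have "exp (4 * (ln K + 1)) * K \<le> 4 ^ m"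
  proof -
    assume a: "55 * K ^ 5 \<le> 4 ^ m" "exp (4 * (ln K + 1)) = K ^ 4 * exp 1 ^ 4" "exp 1 ^ 4 \<le> (55 :: real)"
    have "K ^ 4 * exp 1 ^ 4 * K = K ^ 5 * exp 1 ^ 4" by (simp add: power_numeral_reduce)
    also have "\<dots> \<le> K ^ 5 * 55" using a K by (intro mult_left_mono) auto
    finally show ?thesis using a by simp
  qed
  then show "exp (4 * (ln K + 1)) / 4 ^ m \<le> 1 / K"
    using K by (simp add: field_simps)
  \<comment> \<open>Write \<open>2 = 7/4 * (8/7)\<close>: by Bernoulli's inequality the powers of
    \<open>8/7\<close> absorb the linear growth of \<open>m\<close>, and \<open>2 ^ 36 / 108\<close>
    exceeds 636000000.\<close>
  have Hm: "real H \<ge> 636000000 * (7/4) ^ i * real m"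
  proof -
    have "real m \<le> 108 * (1 + real i * (1/7))" by (simp add: m_def)
    also have "\<dots> \<le> 108 * (1 + 1/7) ^ i" using Bernoulli_inequality[of "1/7 :: real" i] by simp
    finally have "636000000 * (7/4) ^ i * real m \<le> 636000000 * (7/4) ^ i * (108 * (1 + 1/7) ^ i)"
      by (intro mult_left_mono) auto
    also have "\<dots> = 636000000 * 108 * (7/4 * (8/7)) ^ i" unfolding power_mult_distrib by simp
    also have "\<dots> \<le> 2 ^ 36 * 2 ^ i" by simp
    finally show ?thesis by (simp add: H_def power_add)
  qed
  have one: "(7/4 :: real) ^ i \<ge> 1" by (rule one_le_power) simp
  have mpos: "m > 0" by (simp add: m_def)
  have "real H < (real (H div m) + 1) * real m"
  proof -
    have "H < (H div m + 1) * m" using mpos by (metis dividend_less_div_times mult.commute Suc_eq_plus1 mult_Suc)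
    then show ?thesis by (metis of_nat_1 of_nat_add of_nat_less_iff of_nat_mult)
  qed
  then have "636000000 * (7/4) ^ i * real m < (real (H div m) + 1) * real m" using Hm by simp
  then have Hdiv: "636000000 * (7/4) ^ i < real (H div m) + 1" using mpos by simp
  then have "H div m \<ge> 4" using one by linarith
  then have u4: "H div m = u + 4" by (simp add: u_def)
  have u: "real u \<ge> 600000000 * (7/4) ^ i"
  proof -
    have "real (H div m) = real u + 4" by (simp add: u4)
    then show ?thesis using Hdiv one by linarith
  qed
  then show "u \<ge> 33" using one by linarith
  \<comment> \<open>The 4 subtracted in \<open>u\<close> is spent here: \<open>5 \<le> 2 ^ 3\<close>
    uses three factors 2 for each of the \<open>m\<close> primes, and the fourth pays for
    \<open>exp 1 * K\<close>.\<close>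
  have "exp 1 * K \<le> 2 ^ m"
  proof -
    have "exp 1 * K \<le> 4 * K" using e3 K by (intro mult_right_mono) auto
    also have "\<dots> = 4 * 3 * 10 ^ 12 * 3 ^ i" by (simp add: K_def)
    also have "\<dots> \<le> 2 ^ 108 * 16 ^ i" by (intro mult_mono power_mono) auto
    also have "\<dots> = 2 ^ m" by (simp add: m_def power_add power_mult)
    finally show ?thesis .
  qed
  moreover have "(5 * 2 ^ u) ^ m \<le> ((2 :: real) ^ (u + 3)) ^ m"
    by (intro power_mono) (auto simp: power_add)
  ultimately have "(exp 1 * K) * (5 * 2 ^ u) ^ m \<le> 2 ^ m * ((2 :: real) ^ (u + 3)) ^ m"
    by (intro mult_mono) auto
  also have "\<dots> = 2 ^ (m * (u + 4))" by (simp add: algebra_simps flip: power_mult power_add)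
  also have "\<dots> \<le> 2 ^ H"
    unfolding u4[symmetric] by (intro power_increasing) auto
  finally show "exp 1 * (5 * 2 ^ u) ^ m \<le> 2 ^ H / K"
    using K by (simp add: field_simps)
  have "exp (101/10) * K \<le> (real u * ln 2) ^ 2"
  proof -
    have "exp (101/10) * K \<le> 25000 * K" using exp_ten_point_one_le K by (intro mult_right_mono) auto
    also have "\<dots> = 25000 * (3 * 10 ^ 12) * 3 ^ i" by (simp add: K_def)
    also have "\<dots> \<le> 160000000000000000 * (49/16) ^ i" by (intro mult_mono power_mono) auto
    also have "\<dots> = (600000000 * (7/4) ^ i * (2/3)) ^ 2"
      by (simp add: power_mult_distrib flip: power_mult) (simp add: power_mult mult.commute[of i] power2_eq_square)
    also have "\<dots> \<le> (real u * ln 2) ^ 2"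
      using u ln2_ge_two_thirds by (intro power_mono mult_mono) auto
    finally show ?thesis .
  qed
  then have "ln (exp (101/10) * K) \<le> ln ((real u * ln 2) ^ 2)"
    using K \<open>u \<ge> 33\<close> by (subst ln_le_cancel_iff) auto
  moreover have "real u * ln 2 > 0" using \<open>u \<ge> 33\<close> by simp
  ultimately show "ln K \<le> 2 * ln (real u * ln 2) - 101/10"
    using K by (subst (asm) ln_mult_pos) (auto simp: ln_realpow)
qed

text \<open>Kept as a constant because the simplifier would evaluate the numeral.\<close>
definition double_exp :: "nat \<Rightarrow> nat" where "double_exp j = 2 ^ 2 ^ j"

locale sifted_primes =
  fixes l :: nat and W S :: "nat set"
  assumes l: "l = 3 \<or> l = 5"
    and W: "finite W" "(\<Sum>r\<in>W. 1 / real r) \<le> 7/10"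
    and S: "finite S" "\<And>q. q \<in> S \<Longrightarrow> double_exp 36 < q"
    and sifted: "\<And>q r. q \<in> S \<Longrightarrow> prime r \<Longrightarrow> r \<notin> W \<Longrightarrow> \<not> r dvd q"
      "\<And>q r. q \<in> S \<Longrightarrow> prime r \<Longrightarrow> r \<notin> W \<Longrightarrow> r mod l = 1 \<Longrightarrow> \<not> r dvd (\<Sum>i<l. q ^ i)"
begin

definition \<Omega> :: "nat \<Rightarrow> nat set" where
  "\<Omega> r = (if r mod l = 1 then insert 0 (SOME A. A \<subseteq> {1..<r} \<and> card A = l - 1 \<and> (\<forall>c\<in>A. r dvd (\<Sum>i<l. c ^ i))) else {0})"

lemma 
  assumes r: "prime r"
  shows \<Omega>_subset: "\<Omega> r \<subseteq> {..<r}" and card_\<Omega>: "card (\<Omega> r) = sieve_dim l r"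
    and \<Omega>_sifted: "q \<in> S \<Longrightarrow> r \<notin> W \<Longrightarrow> q mod r \<notin> \<Omega> r"
proof -
  have r0: "r > 0" using r prime_gt_0_nat by blast
  have "\<Omega> r \<subseteq> {..<r} \<and> card (\<Omega> r) = sieve_dim l r \<and> (q \<in> S \<longrightarrow> r \<notin> W \<longrightarrow> q mod r \<notin> \<Omega> r)"
  proof (cases "r mod l = 1")
    case True
    define A where "A = (SOME A. A \<subseteq> {1..<r} \<and> card A = l - 1 \<and> (\<forall>c\<in>A. r dvd (\<Sum>i<l. c ^ i)))"
    have "\<exists>A. A \<subseteq> {1..<r} \<and> card A = l - 1 \<and> (\<forall>c\<in>A. r dvd (\<Sum>i<l. c ^ i))"
      using l True r by (intro exists_cyclotomic_roots) auto
    from someI_ex[OF this] have A: "A \<subseteq> {1..<r}" "card A = l - 1" "\<And>c. c \<in> A \<Longrightarrow> r dvd (\<Sum>i<l. c ^ i)"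
      unfolding A_def[symmetric] by blast+
    have \<Omega>: "\<Omega> r = insert 0 A" using True by (simp add: \<Omega>_def A_def)
    have "finite A" "0 \<notin> A" using A(1) finite_subset by auto
    then have "card (\<Omega> r) = sieve_dim l r" unfolding \<Omega> using A(2) l True by (auto simp: sieve_dim_def)
    moreover have "q mod r \<notin> \<Omega> r" if q: "q \<in> S" "r \<notin> W"
    proof
      assume "q mod r \<in> \<Omega> r"
      then consider "q mod r = 0" | "q mod r \<in> A" unfolding \<Omega> by auto
      then show False
      proof cases
        case 1
        then show False using sifted(1)[OF q(1) r q(2)] by (simp add: dvd_eq_mod_eq_0)
      next
        case 2
        have "[(\<Sum>i<l. (q mod r) ^ i) = (\<Sum>i<l. q ^ i)] (mod r)"
          by (intro cong_sum cong_pow) (simp add: cong_def)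
        then have "r dvd (\<Sum>i<l. q ^ i)" using A(3)[OF 2] cong_dvd_iff by blast
        then show False using sifted(2)[OF q(1) r q(2) True] by blast
      qed
    qed
    ultimately show ?thesis using A(1) r0 unfolding \<Omega> by auto
  next
    case False
    then show ?thesis using r0 sifted(1)[OF _ r] by (auto simp: \<Omega>_def sieve_dim_def dvd_eq_mod_eq_0)
  qed
  then show "\<Omega> r \<subseteq> {..<r}" "card (\<Omega> r) = sieve_dim l r" "q \<in> S \<Longrightarrow> r \<notin> W \<Longrightarrow> q mod r \<notin> \<Omega> r" by blast+
qed

lemma card_dyadic_le:
  fixes i k :: nat
  assumes k: "2 ^ (i + 36) \<le> k"
  defines "K \<equiv> 3 * 10 ^ 12 * 3 ^ i :: real"
  shows "real (card {q \<in> S. 2 ^ k < q \<and> q \<le> 2 ^ Suc k}) \<le> 3 * 2 ^ k / K"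
proof -
  define m where "m = 4 * i + 108"
  define H :: nat where "H = 2 ^ (i + 36)"
  define u where "u = H div m - 4"
  define z :: nat where "z = 2 ^ u"
  note par = sieve_parameters[of i, folded m_def H_def K_def, folded u_def]
  have "1 * 1 \<le> 3 * 10 ^ 12 * (3 :: real) ^ i" by (intro mult_mono) auto
  then have K: "K \<ge> 1" by (simp only: K_def)
  define a where "a = (\<lambda>r. real (sieve_dim l r) / real r)"
  define V where "V = {r. prime r \<and> r \<le> z}"
  have V: "finite V" "\<And>r. r \<in> V \<Longrightarrow> prime r" by (auto simp: V_def)
  have a: "0 \<le> a r" "a r \<le> 1" "a r \<le> 5 * (1 / real r)" if "prime r" for r
  proof -
    show "0 \<le> a r" by (simp add: a_def)
    have "card (\<Omega> r) \<le> r" using card_mono[OF _ \<Omega>_subset[OF that]] by simp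
    then show "a r \<le> 1" using prime_gt_0_nat[OF that] by (simp add: a_def card_\<Omega>[OF that])
    show "a r \<le> 5 * (1 / real r)" using l by (auto simp: a_def sieve_dim_def divide_right_mono)
  qed
  have "z \<ge> 2 ^ 33" unfolding z_def using par(3) by (intro power_increasing) auto
  then have "2 * ln (ln (real z)) - 33/5 \<le> sum a V"
    unfolding a_def V_def using sum_primes_sieve_dim_over_ge[OF l] by blast
  moreover have "ln (real z) = real u * ln 2" by (simp add: z_def ln_realpow)
  moreover have "sum a V = sum a (V - W) + sum a (V \<inter> W)"
    using V by (metis sum.Int_Diff add.commute)
  moreover have "sum a (V \<inter> W) \<le> 7/2"
  proof -
    have "sum a (V \<inter> W) \<le> (\<Sum>r\<in>V \<inter> W. 5 * (1 / real r))" using V a by (intro sum_mono) auto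
    also have "\<dots> \<le> (\<Sum>r\<in>W. 5 * (1 / real r))" using W by (intro sum_mono2) auto
    also have "\<dots> = 5 * (\<Sum>r\<in>W. 1 / real r)" by (simp add: sum_distrib_left)
    finally show ?thesis using W(2) by linarith
  qed
  ultimately have "ln K \<le> sum a (V - W)" using par(4) by simp
  then obtain P where P: "P \<subseteq> V - W" "ln K \<le> sum a P" "sum a P \<le> ln K + 1"
    using exists_subset_sum_between[of "V - W" a "ln K"] V a K by auto
  have P': "finite P" "\<And>r. r \<in> P \<Longrightarrow> prime r" "\<And>r. r \<in> P \<Longrightarrow> \<Omega> r \<subseteq> {..<r}"
    using P(1) V finite_subset[of P V] \<Omega>_subset by auto
  have sumP: "(\<Sum>r\<in>P. real (card (\<Omega> r)) / real r) = sum a P"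
    unfolding a_def using P' card_\<Omega> by (intro sum.cong) auto
  have "{q \<in> S. 2 ^ k < q \<and> q \<le> 2 ^ Suc k} \<subseteq> {n \<in> {2 ^ k<..2 ^ k + 2 ^ k}. \<forall>r\<in>P. n mod r \<notin> \<Omega> r}"
    using P(1) P' \<Omega>_sifted by auto
  then have "card {q \<in> S. 2 ^ k < q \<and> q \<le> 2 ^ Suc k} \<le> card {n \<in> {2 ^ k<..2 ^ k + 2 ^ k}. \<forall>r\<in>P. n mod r \<notin> \<Omega> r}"
    by (intro card_mono) auto
  then have "real (card {q \<in> S. 2 ^ k < q \<and> q \<le> 2 ^ Suc k}) \<le> real (card {n \<in> {2 ^ k<..2 ^ k + 2 ^ k}. \<forall>r\<in>P. n mod r \<notin> \<Omega> r})"
    by simp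
  also have "\<dots> \<le> real (2 ^ k) * (exp (- sum a P) + exp (4 * sum a P) / 4 ^ m) + exp 1 * (5 * 2 ^ u) ^ m"
    unfolding sumP[symmetric]
  proof (rule brun_sieve[OF P'])
    show "even m" by (simp add: m_def)
    show "1 \<le> 5 * (2 :: real) ^ u" using one_le_power[of "2 :: real" u] by linarith
    have "(\<Sum>r\<in>P. real (card (\<Omega> r))) \<le> (\<Sum>r\<in>P. 5)"
      using l by (intro sum_mono) (auto simp: card_\<Omega>[OF P'(2)] sieve_dim_def)
    moreover have "P \<subseteq> {1..z}" using P(1) prime_ge_1_nat by (auto simp: V_def)
    then have "card P \<le> card {1..z}" by (rule card_mono[rotated]) simp
    then have "real (card P) \<le> 2 ^ u" by (simp add: z_def)
    ultimately show "(\<Sum>r\<in>P. real (card (\<Omega> r))) \<le> 5 * 2 ^ u"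
      unfolding sum_constant by linarith
  qed
  also have "\<dots> \<le> real (2 ^ k) * (1 / K + 1 / K) + 2 ^ k / K"
  proof (intro add_mono mult_left_mono)
    have "exp (- sum a P) \<le> exp (- ln K)" using P by simp
    then show "exp (- sum a P) \<le> 1 / K" using K by (simp add: exp_minus field_simps)
    have "exp (4 * sum a P) / 4 ^ m \<le> exp (4 * (ln K + 1)) / 4 ^ m"
      using P by (intro divide_right_mono) auto
    then show "exp (4 * sum a P) / 4 ^ m \<le> 1 / K" using par(1) by linarith
    have "(2 :: real) ^ H / K \<le> 2 ^ k / K"
      using k K by (intro divide_right_mono power_increasing) (auto simp: H_def)
    then show "exp 1 * (5 * 2 ^ u) ^ m \<le> 2 ^ k / K" using par(2) by linarith
  qed auto
  also have "\<dots> = 3 * 2 ^ k / K" by (simp add: field_simps)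
  finally show ?thesis .
qed

lemma sum_inverse_block_le:
  fixes i n :: nat
  defines "K \<equiv> 3 * 10 ^ 12 * 3 ^ i :: real" and "b \<equiv> 2 ^ (i + 36) :: nat"
  shows "(\<Sum>q | q \<in> S \<and> 2 ^ b < q \<and> q \<le> 2 ^ (b + n). 1 / real q) \<le> real n * (3 / K)"
proof (induction n)
  case 0
  have "{q \<in> S. 2 ^ b < q \<and> q \<le> 2 ^ (b + 0)} = {}" by auto
  then show ?case by (simp only: sum.empty)
next
  case (Suc n)
  define D where "D = {q \<in> S. 2 ^ (b + n) < q \<and> q \<le> 2 ^ Suc (b + n)}"
  have eq: "{q \<in> S. 2 ^ b < q \<and> q \<le> 2 ^ (b + Suc n)} = {q \<in> S. 2 ^ b < q \<and> q \<le> 2 ^ (b + n)} \<union> D"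
  proof -
    have split: "{q \<in> S. x < q \<and> q \<le> z} = {q \<in> S. x < q \<and> q \<le> y} \<union> {q \<in> S. y < q \<and> q \<le> z}"
      if "x \<le> y" "y \<le> z" for x y z :: nat
      using that by auto
    show ?thesis unfolding D_def add_Suc_right by (rule split; rule power_increasing) auto
  qed
  have "(\<Sum>q | q \<in> S \<and> 2 ^ b < q \<and> q \<le> 2 ^ (b + Suc n). 1 / real q)
      = (\<Sum>q | q \<in> S \<and> 2 ^ b < q \<and> q \<le> 2 ^ (b + n). 1 / real q) + (\<Sum>q\<in>D. 1 / real q)"
    unfolding eq by (rule sum.union_disjoint) (use S(1) in \<open>auto simp: D_def\<close>)
  also have "(\<Sum>q\<in>D. 1 / real q) \<le> (\<Sum>q\<in>D. 1 / 2 ^ (b + n))"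
  proof (rule sum_mono)
    fix q assume "q \<in> D"
    then have "2 ^ (b + n) \<le> q" by (simp add: D_def)
    then have "real (2 ^ (b + n)) \<le> real q" by (simp only: of_nat_le_iff)
    then have "2 ^ (b + n) \<le> real q" unfolding of_nat_power of_nat_numeral .
    then show "1 / real q \<le> 1 / 2 ^ (b + n)" by (rule frac_le[rotated 3]) auto
  qed
  also have "\<dots> = real (card D) / 2 ^ (b + n)" by simp
  also have "\<dots> \<le> (3 * 2 ^ (b + n) / K) / 2 ^ (b + n)"
    unfolding D_def K_def by (intro divide_right_mono card_dyadic_le) (auto simp: b_def)
  also have "\<dots> = 3 / K" by simp
  finally show ?case using Suc unfolding of_nat_Suc distrib_right mult_1_left by linarith
qed

lemma sum_inverse_le_double_exp:
  "(\<Sum>q | q \<in> S \<and> q \<le> double_exp (i + 36). 1 / real q) \<le> 21/100 * (1 - (2/3) ^ i)"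
proof (induction i)
  case 0
  have "{q \<in> S. q \<le> double_exp (0 + 36)} = {}" using S(2) by (auto simp: not_le)
  then have "(\<Sum>q | q \<in> S \<and> q \<le> double_exp (0 + 36). 1 / real q) = (\<Sum>q\<in>{}. 1 / real q)"
    by (rule arg_cong)
  then show ?case by simp
next
  case (Suc i)
  define b :: nat where "b = 2 ^ (i + 36)"
  have "2 ^ (Suc i + 36) = b + b" by (simp add: b_def power_add)
  then have bb: "double_exp (Suc i + 36) = 2 ^ (b + b)" "double_exp (i + 36) = 2 ^ b"
    by (simp_all only: double_exp_def b_def)
  have split: "{q \<in> S. q \<le> z} = {q \<in> S. q \<le> y} \<union> {q \<in> S. y < q \<and> q \<le> z}" if "y \<le> z" for y z :: nat
    using that by auto
  have eq: "{q \<in> S. q \<le> 2 ^ (b + b)} = {q \<in> S. q \<le> 2 ^ b} \<union> {q \<in> S. 2 ^ b < q \<and> q \<le> 2 ^ (b + b)}"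
    by (rule split, rule power_increasing) auto
  have "(\<Sum>q | q \<in> S \<and> q \<le> 2 ^ (b + b). 1 / real q)
      = (\<Sum>q | q \<in> S \<and> q \<le> 2 ^ b. 1 / real q) + (\<Sum>q | q \<in> S \<and> 2 ^ b < q \<and> q \<le> 2 ^ (b + b). 1 / real q)"
    unfolding eq by (rule sum.union_disjoint) (use S(1) in auto)
  also have "\<dots> \<le> 21/100 * (1 - (2/3) ^ i) + real b * (3 / (3 * 10 ^ 12 * 3 ^ i))"
    using Suc.IH sum_inverse_block_le[of i b] unfolding bb(2) b_def[symmetric] by (rule add_mono)
  also have "real b * (3 / (3 * 10 ^ 12 * 3 ^ i)) = 2 ^ 36 / 10 ^ 12 * (2/3) ^ i"
    by (simp add: b_def power_add power_divide)
  also have "\<dots> \<le> 7/100 * (2/3) ^ i" by (intro mult_right_mono) auto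
  finally show ?case unfolding bb(1) power_Suc right_diff_distrib by linarith
qed

lemma sum_inverse_le: "(\<Sum>q\<in>S. 1 / real q) \<le> 21/100"
proof -
  obtain i where i: "\<And>q. q \<in> S \<Longrightarrow> q \<le> i" using S(1) finite_nat_set_iff_bounded_le by auto
  have "i \<le> double_exp (i + 36)"
  proof -
    have "i \<le> i + 36" by simp
    also have "\<dots> \<le> 2 ^ (i + 36)" by (rule less_imp_le[OF less_exp])
    also have "\<dots> \<le> double_exp (i + 36)" unfolding double_exp_def by (rule less_imp_le[OF less_exp])
    finally show ?thesis .
  qed
  then have "{q \<in> S. q \<le> double_exp (i + 36)} = S" using i le_trans by blast
  then have "(\<Sum>q\<in>S. 1 / real q) \<le> 21/100 * (1 - (2/3) ^ i)" using sum_inverse_le_double_exp[of i] by simp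
  also have "\<dots> \<le> 21/100" by simp
  finally show ?thesis .
qed

end

lemma sum_Un_le:
  fixes f :: "'a \<Rightarrow> real"
  assumes "finite A" "finite B" "\<And>x. 0 \<le> f x"
  shows "sum f (A \<union> B) \<le> sum f A + sum f B"
  using sum.union_inter[OF assms(1,2), of f] sum_nonneg[of "A \<inter> B" f] assms(3) by simp

theorem theorem1p2:
  fixes p e s t N :: nat and q :: "nat \<Rightarrow> nat"
  assumes "prime p" and "odd p"
    and "\<And>i. i \<in> {1..s + t} \<Longrightarrow> prime (q i) \<and> odd (q i)"
    and "inj_on q {1..s + t}"
    and "p \<notin> q ` {1..s + t}"
    and "e > 0"
    and "N = p ^ e * (\<Prod>i\<in>{1..s}. q i ^ 2) * (\<Prod>i\<in>{s + 1..s + t}. q i ^ 4)"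
    and "odd N" and "perfect_number N"
  shows "\<exists>r::nat. prime r \<and> r dvd N \<and> real r < exp (4.97401 * 10 ^ 10)"
proof (rule ccontr)
  assume neg: "\<not> ?thesis"
  have N: "N > 0" "divisor_sigma N = 2 * N" using \<open>perfect_number N\<close> by (auto simp: perfect_number_def)
  define d where "d = (\<lambda>i. if i \<le> s then 2 else 4 :: nat)"
  define I where "I = {1..s + t}"
  have qI: "prime (q i)" if "i \<in> I" for i using assms(3) that by (auto simp: I_def)
  have Nd: "N = p ^ e * (\<Prod>i\<in>I. q i ^ d i)"
  proof -
    have "I = {1..s} \<union> {s + 1..s + t}" by (auto simp: I_def)
    then have "(\<Prod>i\<in>I. q i ^ d i) = (\<Prod>i\<in>{1..s}. q i ^ d i) * (\<Prod>i\<in>{s + 1..s + t}. q i ^ d i)"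
      by (simp add: prod.union_disjoint)
    then show ?thesis unfolding assms(7) by (simp add: d_def mult.assoc)
  qed
  have big: "double_exp 36 < r" if "prime r" "r dvd N" for r
  proof -
    have "real (double_exp 36) = 2 ^ (2 ^ 36)"
      by (simp only: double_exp_def of_nat_power of_nat_numeral)
    also have "\<dots> = exp (real (2 ^ 36) * ln 2)"
      by (subst exp_of_nat_mult) (simp only: exp_ln zero_less_numeral)
    also have "\<dots> < exp (4.97401 * 10 ^ 10)"
      unfolding exp_less_cancel_iff using ln2_le_25_over_36 by simp
    also have "\<dots> \<le> real r" using neg that by (meson not_le)
    finally show ?thesis by (simp only: of_nat_less_iff)
  qed
  have big': "r \<ge> 1001" if "prime r" "r dvd N" for r
  proof -
    have "(2 :: nat) ^ 10 \<le> double_exp 36" unfolding double_exp_def by (rule power_increasing) auto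
    then show ?thesis using big[OF that] by simp
  qed
  have q_dvd: "q i ^ d i dvd N" if "i \<in> I" for i
    unfolding Nd using that by (intro dvd_mult dvd_prodI) (auto simp: I_def)
  have d0: "d i > 0" for i by (simp add: d_def)
  have q_dvd': "q i dvd N" if "i \<in> I" for i
    using dvd_trans[OF dvd_power[of "d i" "q i"] q_dvd[OF that]] d0[of i] by blast
  have sigma_dvd: "(\<Sum>k\<le>d i. q i ^ k) dvd 2 * N" if i: "i \<in> I" for i
  proof -
    define R where "R = p ^ e * (\<Prod>j\<in>I - {i}. q j ^ d j)"
    have "N = q i ^ d i * R"
      unfolding Nd R_def using prod.remove[of I i "\<lambda>j. q j ^ d j"] i by (simp add: I_def mult_ac)
    moreover have "coprime (q i ^ d i) R"
    proof -
      have "q i \<noteq> p" using assms(5) i by (auto simp: I_def)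
      then have "coprime (q i) p" by (intro primes_coprime qI i assms(1))
      moreover have "coprime (q i) (\<Prod>j\<in>I - {i}. q j ^ d j)"
      proof (rule prod_coprime_right)
        fix j assume j: "j \<in> I - {i}"
        then have "q i \<noteq> q j" using inj_onD[OF assms(4), of i j] i by (auto simp: I_def)
        then have "coprime (q i) (q j)" using j by (intro primes_coprime qI i) auto
        then show "coprime (q i) (q j ^ d j)" by simp
      qed
      ultimately show ?thesis by (simp add: R_def)
    qed
    ultimately have "divisor_sigma N = divisor_sigma (q i ^ d i) * divisor_sigma R"
      using N by (simp add: divisor_sigma_mult_coprime)
    then have "divisor_sigma (q i ^ d i) dvd divisor_sigma N" by simp
    then show ?thesis unfolding N(2) divisor_sigma_prime_power[OF qI[OF i]] .
  qed
  define W where "W = prime_factors N"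
  have W: "finite W" "(\<Sum>r\<in>W. 1 / real r) \<le> 7/10" "(\<Sum>r\<in>W. 1 / real r) \<ge> 6/10"
    unfolding W_def using perfect_sum_inverse_primes_le[OF assms(9) big']
      perfect_sum_inverse_primes_ge[OF assms(9) big'] by simp_all
  have W': "r \<in> W \<longleftrightarrow> prime r \<and> r dvd N" for r using N by (auto simp: W_def in_prime_factors_iff)
  have sp: "sifted_primes l W (q ` J)" if l: "l = 3 \<or> l = 5" and J: "J \<subseteq> I" "\<And>i. i \<in> J \<Longrightarrow> Suc (d i) = l" for l J
  proof
    show "l = 3 \<or> l = 5" by fact
    show "finite W" "(\<Sum>r\<in>W. 1 / real r) \<le> 7/10" by fact+
    show "finite (q ` J)" using J(1) finite_subset[of J I] by (simp add: I_def)
    fix x assume "x \<in> q ` J"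
    then obtain i where i: "i \<in> J" "i \<in> I" "x = q i" using J by blast
    show "double_exp 36 < x" using big[OF qI[OF i(2)] q_dvd'[OF i(2)]] i(3) by simp
    fix r :: nat assume r: "prime r" "r \<notin> W"
    show "\<not> r dvd x" using r dvd_trans[OF _ q_dvd'[OF i(2)]] i(3) W'[of r] by blast
    assume rl: "r mod l = 1"
    show "\<not> r dvd (\<Sum>k<l. x ^ k)"
    proof
      assume "r dvd (\<Sum>k<l. x ^ k)"
      moreover have "{..<l} = {..d i}" using J(2)[OF i(1)] lessThan_Suc_atMost[of "d i"] by simp
      ultimately have "r dvd 2 * N" using dvd_trans[OF _ sigma_dvd[OF i(2)]] i(3) by simp
      then have "r dvd 2" using r W'[of r] prime_dvd_multD[OF r(1)] by blast
      then have "r = 2" using r(1) by (simp add: primes_dvd_imp_eq)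
      then show False using rl l by auto
    qed
  qed
  have S3: "(\<Sum>x\<in>q ` {1..s}. 1 / real x) \<le> 21/100"
    by (rule sifted_primes.sum_inverse_le, rule sp[of 3]) (auto simp: I_def d_def)
  have S5: "(\<Sum>x\<in>q ` {s + 1..s + t}. 1 / real x) \<le> 21/100"
    by (rule sifted_primes.sum_inverse_le, rule sp[of 5]) (auto simp: I_def d_def)
  have "W \<subseteq> {p} \<union> (q ` {1..s} \<union> q ` {s + 1..s + t})"
  proof
    fix r assume "r \<in> W"
    then have r: "prime r" "r dvd p ^ e * (\<Prod>i\<in>I. q i ^ d i)" using W' Nd by auto
    then consider "r dvd p ^ e" | "r dvd (\<Prod>i\<in>I. q i ^ d i)" by (auto simp: prime_dvd_mult_iff)
    then show "r \<in> {p} \<union> (q ` {1..s} \<union> q ` {s + 1..s + t})"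
    proof cases
      case 1
      then have "r = p" by (rule primes_dvd_imp_eq[OF r(1) assms(1) prime_dvd_power[OF r(1)]])
      then show ?thesis by simp
    next
      case 2
      then obtain i where i: "i \<in> I" "r dvd q i ^ d i" using r(1) by (auto simp: prime_dvd_prod_iff I_def)
      then have "r = q i" using primes_dvd_imp_eq[OF r(1) qI prime_dvd_power[OF r(1)]] by blast
      then show ?thesis using i(1) by (cases "i \<le> s") (auto simp: I_def)
    qed
  qed
  then have "(\<Sum>r\<in>W. 1 / real r) \<le> (\<Sum>r\<in>{p} \<union> (q ` {1..s} \<union> q ` {s + 1..s + t}). 1 / real r)"
    by (intro sum_mono2) auto
  also have "\<dots> \<le> (\<Sum>r\<in>{p}. 1 / real r) + (\<Sum>r\<in>q ` {1..s} \<union> q ` {s + 1..s + t}. 1 / real r)"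
    by (rule sum_Un_le) auto
  also have "(\<Sum>r\<in>q ` {1..s} \<union> q ` {s + 1..s + t}. 1 / real r) \<le> (\<Sum>r\<in>q ` {1..s}. 1 / real r) + (\<Sum>r\<in>q ` {s + 1..s + t}. 1 / real r)"
    by (rule sum_Un_le) auto
  also have "(\<Sum>r\<in>{p}. 1 / real r) \<le> 1/1001"
  proof -
    have "p dvd N" unfolding Nd using assms(6) by (simp add: dvd_power)
    then have "real p \<ge> 1001" using big'[OF assms(1)] by simp
    then show ?thesis by (simp add: frac_le)
  qed
  finally show False using S3 S5 W(3) by simp
qed

end
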